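(* Suppose that for all $x,x_1,x_2\in\mathbb{R}^n$ and $(s,a)\in\mathcal{S}\times\mathcal{A}$: $|r_{sa}(x)|\le C_r$, $\|\nabla r_{sa}(x)\|_2\le C_{rx}$, $\|\nabla r_{sa}(x_1)-\nabla r_{sa}(x_2)\|_2\le L_r\|x_1-x_2\|_2$; and that for all trajectory tuples $\boldsymbol d=(d_1,\dots,d_I)$ and $x,x_1,x_2\in\mathbb{R}^n$: $|l(\boldsymbol d;x)|\le C_l$, $l(\boldsymbol d;\cdot)$ is continuously differentiable, $|l(\boldsymbol d;x_1)-l(\boldsymbol d;x_2)|\le L_l\|x_1-x_2\|_2$, $\|\nabla l(\boldsymbol d;x_1)-\nabla l(\boldsymbol d;x_2)\|_2\le L_{l1}\|x_1-x_2\|_2$. Then for any $x_1,x_2\in\mathbb{R}^n$, $$\|\nabla\phi(x_1)-\nabla\phi(x_2)\|_2\le L_\phi\|x_1-x_2\|_2,$$ where $$L_\phi=L_{l1}+L_lHIL_\pi\sqrt{|\mathcal{A}|}+2\tau^{-1}HI\Big(C_lL_{V1}+\frac{C_{rx}}{1-\gamma}L_l\Big)+\frac{2H^2I^2C_lC_{rx}L_\pi}{\tau(1-\gamma)}\sqrt{|\mathcal{A}|},$$ $$L_\pi=\frac{2\sqrt{|\mathcal{S}||\mathcal{A}|}\,C_{rx}}{\tau(1-\gamma)},\qquad L_{V1}=\frac{(1+\gamma)C_{rx}L_\pi\sqrt{|\mathcal{A}|}}{(1-\gamma)^2}+\frac{L_r}{1-\gamma}.$$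
   Context: Lower level. $\mathcal{S},\mathcal{A}$ finite nonempty sets, $P_{sas'}=P(s'|s,a)$ a transition kernel, $\gamma\in(0,1)$, $\tau>0$, $r:\mathbb{R}^n\to\mathbb{R}^{|\mathcal{S}||\mathcal{A}|}$ a continuously differentiable parameterized reward. A policy is $\pi=(\pi_s)_s$ with each $\pi_s=\pi(\cdot|s)$ a probability distribution on $\mathcal{A}$. With $h(\pi_s)=-\sum_a\pi_{sa}\log\pi_{sa}$ ($0\log0=0$), $V^\pi_s(x)=\mathbb{E}[\sum_{t\ge0}\gamma^t(r_{s_ta_t}(x)+\tau h(\pi_{s_t}))\mid s_0=s,\pi]$ (with $a_t\sim\pi(\cdot|s_t)$, $s_{t+1}\sim P(\cdot|s_t,a_t)$). For $\rho$ a distribution on $\mathcal{S}$ with positive entries, $\pi^*(x)$ is the unique maximizer over policies of $\sum_s\rho_sV^\pi_s(x)$. Upper level. $\bar P$ is a transition kernel and $\bar\rho$ an initial distribution on the same $\mathcal{S},\mathcal{A}$; $I,H\ge1$ are integers. For a policy $\pi$, $\rho(d;\pi)$ is the distribution on $H$-step trajectories $d=\{(s_h,a_h)\}_{h=0}^{H-1}$ with $P(d;\pi)=\bar\rho(s_0)[\prod_{h=0}^{H-2}\pi(a_h|s_h)\bar P(s_{h+1}|s_h,a_h)]\pi(a_{H-1}|s_{H-1})$. The hyper-objective is $\phi(x)=f(x,\pi^*(x))$ with $f(x,\pi)=\mathbb{E}[l(d_1,\dots,d_I;x)]$, $d_1,\dots,d_I$ drawn independently from $\rho(d;\pi)$,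 $l$ a real-valued function; $\nabla l$ is its gradient in $x$. *)

theory Defs
  imports "HOL-Probability.Probability"
begin

text \<open>The library has the relation \<^const>\<open>gderiv\<close>, but no gradient as a function. The value is
  only meaningful at points of differentiability.\<close>

definition gradient :: "('v::real_inner \<Rightarrow> real) \<Rightarrow> 'v \<Rightarrow> 'v" where
  "gradient f x = (THE D. GDERIV f x :> D)"

lemma GDERIV_unique:
  assumes "GDERIV f x :> D" and "GDERIV f x :> E"
  shows "D = E"
proof -
  have "(\<lambda>h. inner h D) = (\<lambda>h. inner h E)"
    using assms unfolding gderiv_def by (rule has_derivative_unique)
  then have "inner (D - E) (D - E) = 0"
    by (metis inner_diff_right right_minus_eq)
  then show ?thesis
    by simp
qed

lemma gradient_eqI: "GDERIV f x :> D \<Longrightarrow> gradient f x = D"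
  unfolding gradient_def by (blast intro: GDERIV_unique)

lemma GDERIV_gradient:
  fixes f :: "'v::euclidean_space \<Rightarrow> real"
  assumes "f differentiable (at x)"
  shows "GDERIV f x :> gradient f x"
proof -
  obtain f' where f': "(f has_derivative f') (at x)"
    using assms unfolding differentiable_def by blast
  interpret bounded_linear f'
    using f' by (rule has_derivative_bounded_linear)
  have "f' = (\<lambda>h. inner h (\<Sum>b\<in>Basis. f' b *\<^sub>R b))"
  proof
    fix h
    have "f' h = f' (\<Sum>b\<in>Basis. inner h b *\<^sub>R b)"
      by (simp add: euclidean_representation)
    also have "\<dots> = (\<Sum>b\<in>Basis. inner h b * f' b)"
      by (simp add: sum scaleR)
    finally show "f' h = inner h (\<Sum>b\<in>Basis. f' b *\<^sub>R b)"
      by (simp add: inner_sum_right mult.commute)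
  qed
  with f' have "GDERIV f x :> (\<Sum>b\<in>Basis. f' b *\<^sub>R b)"
    unfolding gderiv_def by (rule subst[where P="\<lambda>g. (f has_derivative g) (at x)", rotated])
  then show ?thesis
    by (simp add: gradient_eqI)
qed

definition continuously_differentiable :: "('v::euclidean_space \<Rightarrow> real) \<Rightarrow> bool" where
  "continuously_differentiable f \<longleftrightarrow>
     (\<forall>x. f differentiable (at x)) \<and> continuous_on UNIV (gradient f)"

section \<open>Lower level: entropy-regularized Markov decision process\<close>

type_synonym ('s, 'a) kernel = "'s \<Rightarrow> 'a \<Rightarrow> 's pmf"
type_synonym ('s, 'a) policy = "'s \<Rightarrow> 'a pmf"

definition policy_entropy :: "'a::finite pmf \<Rightarrow> real" where
  "policy_entropy p = - (\<Sum>a\<in>UNIV. pmf p a * ln (pmf p a))"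

definition act :: "('s, 'a) policy \<Rightarrow> 's \<Rightarrow> ('s \<times> 'a) pmf" where
  "act \<pi> s = map_pmf (\<lambda>a. (s, a)) (\<pi> s)"

text \<open>Conditional law of \<open>(s\<^sub>t, a\<^sub>t)\<close> given the history \<open>(s\<^sub>0, a\<^sub>0), \<dots>\<close>, which is represented by
  \<open>\<omega>\<close> on \<open>{0..<t}\<close>.\<close>

primrec mdp_step :: "('s, 'a) kernel \<Rightarrow> ('s, 'a) policy \<Rightarrow> 's \<Rightarrow>
    nat \<Rightarrow> (nat \<Rightarrow> 's \<times> 'a) \<Rightarrow> ('s \<times> 'a) measure" where
  "mdp_step P \<pi> s 0 \<omega> = measure_pmf (act \<pi> s)"
| "mdp_step P \<pi> s (Suc t) \<omega> = measure_pmf (P (fst (\<omega> t)) (snd (\<omega> t)) \<bind> act \<pi>)"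

text \<open>Law of the whole process \<open>((s\<^sub>t, a\<^sub>t))\<^sub>t\<close> started in \<open>s\<close>: the Ionescu-Tulcea measure.\<close>

definition mdp_law :: "('s, 'a) kernel \<Rightarrow> ('s, 'a) policy \<Rightarrow> 's \<Rightarrow> (nat \<Rightarrow> 's \<times> 'a) measure" where
  "mdp_law P \<pi> s = projective_family.lim UNIV
     (Ionescu_Tulcea.CI (mdp_step P \<pi> s) (\<lambda>_. count_space UNIV)) (\<lambda>_. count_space UNIV)"

lemma Ionescu_Tulcea_mdp_step:
  fixes P :: "('s::finite, 'a::finite) kernel"
  shows "Ionescu_Tulcea (mdp_step P \<pi> s) (\<lambda>_. count_space UNIV)"
proof (rule Ionescu_Tulcea.intro)
  show "prob_space (mdp_step P \<pi> s i \<omega>)" for i \<omega>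
    by (cases i) (auto intro: measure_pmf.prob_space_axioms)
  show "mdp_step P \<pi> s i \<in> measurable (PiM {0..<i} (\<lambda>_. count_space UNIV))
      (subprob_algebra (count_space UNIV))" for i
  proof (cases i)
    case 0
    then show ?thesis
      unfolding 0 mdp_step.simps(1)[abs_def] by (simp add: measure_pmf_in_subprob_algebra)
  next
    case (Suc t)
    have "(\<lambda>z. measure_pmf (P (fst z) (snd z) \<bind> act \<pi>))
        \<in> measurable (count_space UNIV) (subprob_algebra (count_space UNIV))"
      by (simp add: measure_pmf_in_subprob_algebra)
    moreover have "(\<lambda>\<omega>. \<omega> t) \<in> measurable (PiM {0..<i} (\<lambda>_. count_space UNIV)) (count_space UNIV)"
      using Suc by (intro measurable_component_singleton) auto
    ultimately show ?thesis
      unfolding Suc mdp_step.simps(2)[abs_def] by (rule measurable_compose[rotated])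
  qed
qed

definition soft_value :: "('s, 'a::finite) kernel \<Rightarrow> real \<Rightarrow> real \<Rightarrow> ('s \<Rightarrow> 'a \<Rightarrow> real) \<Rightarrow>
    ('s, 'a) policy \<Rightarrow> 's \<Rightarrow> real" where
  "soft_value P \<gamma> \<tau> R \<pi> s =
     (\<integral>\<omega>. (\<Sum>t. \<gamma> ^ t * (R (fst (\<omega> t)) (snd (\<omega> t)) + \<tau> * policy_entropy (\<pi> (fst (\<omega> t)))))
        \<partial>mdp_law P \<pi> s)"

definition optimal_policy :: "('s::finite, 'a::finite) kernel \<Rightarrow> real \<Rightarrow> real \<Rightarrow> 's pmf \<Rightarrow>
    ('s \<Rightarrow> 'a \<Rightarrow> real) \<Rightarrow> ('s, 'a) policy" where
  "optimal_policy P \<gamma> \<tau> \<rho> R =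
     (THE \<pi>. is_arg_max (\<lambda>\<pi>. \<Sum>s\<in>UNIV. pmf \<rho> s * soft_value P \<gamma> \<tau> R \<pi> s) (\<lambda>_. True) \<pi>)"

section \<open>Upper level: finite-horizon trajectories\<close>

type_synonym ('s, 'a) trajectory = "('s \<times> 'a) list"

definition traj_prob :: "('s, 'a) kernel \<Rightarrow> 's pmf \<Rightarrow> nat \<Rightarrow> ('s, 'a) policy \<Rightarrow>
    ('s, 'a) trajectory \<Rightarrow> real" where
  "traj_prob P \<rho> H \<pi> d = (if length d = H then
      pmf \<rho> (fst (d ! 0)) *
      (\<Prod>h<H - 1. pmf (\<pi> (fst (d ! h))) (snd (d ! h)) *
                   pmf (P (fst (d ! h)) (snd (d ! h))) (fst (d ! (h + 1)))) *
      pmf (\<pi> (fst (d ! (H - 1)))) (snd (d ! (H - 1)))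
    else 0)"

definition traj_pmf :: "('s, 'a) kernel \<Rightarrow> 's pmf \<Rightarrow> nat \<Rightarrow> ('s, 'a) policy \<Rightarrow>
    ('s, 'a) trajectory pmf" where
  "traj_pmf P \<rho> H \<pi> = embed_pmf (traj_prob P \<rho> H \<pi>)"

lemma traj_prob_nonneg: "0 \<le> traj_prob P \<rho> H \<pi> d"
  by (simp add: traj_prob_def prod_nonneg)

lemma traj_prob_snoc:
  assumes "length d = Suc n"
  shows "traj_prob P \<rho> (Suc (Suc n)) \<pi> (d @ [(s, a)]) =
    traj_prob P \<rho> (Suc n) \<pi> d * (pmf (P (fst (d ! n)) (snd (d ! n))) s * pmf (\<pi> s) a)"
proof -
  have "(\<Prod>h<n. pmf (\<pi> (fst ((d @ [(s, a)]) ! h))) (snd ((d @ [(s, a)]) ! h)) *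
            pmf (P (fst ((d @ [(s, a)]) ! h)) (snd ((d @ [(s, a)]) ! h)))
              (fst ((d @ [(s, a)]) ! (h + 1)))) =
        (\<Prod>h<n. pmf (\<pi> (fst (d ! h))) (snd (d ! h)) *
            pmf (P (fst (d ! h)) (snd (d ! h))) (fst (d ! (h + 1))))"
    using assms by (intro prod.cong) (auto simp: nth_append)
  then show ?thesis
    using assms by (simp add: traj_prob_def nth_append mult_ac)
qed

lemma sum_pmf_policy:
  fixes p :: "'s::finite pmf" and \<pi> :: "('s, 'a::finite) policy"
  shows "(\<Sum>(s, a)\<in>UNIV. pmf p s * pmf (\<pi> s) a) = 1"
proof -
  have "(\<Sum>(s, a)\<in>UNIV. pmf p s * pmf (\<pi> s) a) = (\<Sum>s\<in>UNIV. \<Sum>a\<in>UNIV. pmf p s * pmf (\<pi> s) a)"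
    by (simp add: sum.cartesian_product)
  then show ?thesis
    by (simp add: sum_distrib_left[symmetric] sum_pmf_eq_1)
qed

lemma sum_traj_prob:
  fixes P :: "('s::finite, 'a::finite) kernel"
  shows "(\<Sum>d | length d = Suc n. traj_prob P \<rho> (Suc n) \<pi> d) = 1"
proof (induction n)
  case 0
  have "{d::('s \<times> 'a) list. length d = Suc 0} = (\<lambda>z. [z]) ` UNIV"
    by (auto simp: length_Suc_conv)
  then have "(\<Sum>d | length d = Suc 0. traj_prob P \<rho> (Suc 0) \<pi> d) =
      (\<Sum>z\<in>UNIV. traj_prob P \<rho> (Suc 0) \<pi> [z])"
    by (simp add: sum.reindex inj_on_def)
  also have "\<dots> = (\<Sum>(s, a)\<in>UNIV. pmf \<rho> s * pmf (\<pi> s) a)"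
    by (intro sum.cong) (auto simp: traj_prob_def)
  finally show ?case
    by (simp add: sum_pmf_policy)
next
  case (Suc n)
  let ?L = "\<lambda>n. {d::('s \<times> 'a) list. length d = n}"
  have L: "?L (Suc (Suc n)) = (\<lambda>(d, z). d @ [z]) ` (?L (Suc n) \<times> UNIV)"
  proof (intro equalityI subsetI)
    fix d :: "('s \<times> 'a) list"
    assume d: "d \<in> ?L (Suc (Suc n))"
    then have "d \<noteq> []"
      by auto
    then have "d = butlast d @ [last d]" "length (butlast d) = Suc n"
      using d by simp_all
    then show "d \<in> (\<lambda>(d, z). d @ [z]) ` (?L (Suc n) \<times> UNIV)"
      by (intro image_eqI[of _ _ "(butlast d, last d)"]) auto
  qed auto
  have "(\<Sum>d\<in>?L (Suc (Suc n)). traj_prob P \<rho> (Suc (Suc n)) \<pi> d) =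
      (\<Sum>d\<in>?L (Suc n). \<Sum>z\<in>UNIV. traj_prob P \<rho> (Suc (Suc n)) \<pi> (d @ [z]))"
    unfolding L
    by (subst sum.reindex) (auto simp: inj_on_def sum.cartesian_product intro!: sum.cong)
  also have "\<dots> = (\<Sum>d\<in>?L (Suc n). traj_prob P \<rho> (Suc n) \<pi> d *
      (\<Sum>(s, a)\<in>UNIV. pmf (P (fst (d ! n)) (snd (d ! n))) s * pmf (\<pi> s) a))"
    by (intro sum.cong) (auto simp: sum_distrib_left traj_prob_snoc intro!: sum.cong)
  also have "\<dots> = 1"
    by (simp add: sum_pmf_policy Suc.IH)
  finally show ?case .
qed

lemma pmf_traj_pmf:
  fixes P :: "('s::finite, 'a::finite) kernel"
  assumes "H \<ge> 1"
  shows "pmf (traj_pmf P \<rho> H \<pi>) d = traj_prob P \<rho> H \<pi> d"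
  unfolding traj_pmf_def
proof (rule pmf_embed_pmf)
  obtain n where n: "H = Suc n"
    using assms by (cases H) auto
  let ?L = "{d::('s \<times> 'a) list. length d = H}"
  have fin: "finite ?L"
    using finite_lists_length_eq[of "UNIV :: ('s \<times> 'a) set" H] by simp
  have "(\<integral>\<^sup>+d. ennreal (traj_prob P \<rho> H \<pi> d) \<partial>count_space UNIV) =
      (\<Sum>d\<in>?L. ennreal (traj_prob P \<rho> H \<pi> d))"
    by (rule nn_integral_count_space'[OF fin]) (auto simp: traj_prob_def)
  also have "\<dots> = ennreal (\<Sum>d\<in>?L. traj_prob P \<rho> H \<pi> d)"
    by (simp add: sum_ennreal traj_prob_nonneg)
  finally show "(\<integral>\<^sup>+d. ennreal (traj_prob P \<rho> H \<pi> d) \<partial>count_space UNIV) = 1"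
    using sum_traj_prob[where P=P and \<rho>=\<rho> and n=n and \<pi>=\<pi>] by (simp add: n)
qed (rule traj_prob_nonneg)

definition traj_tuples :: "nat \<Rightarrow> nat \<Rightarrow> ('s, 'a) trajectory list set" where
  "traj_tuples I H = {D. length D = I \<and> (\<forall>d\<in>set D. length d = H)}"

definition upper_objective :: "('s, 'a) kernel \<Rightarrow> 's pmf \<Rightarrow> nat \<Rightarrow> nat \<Rightarrow>
    (('s, 'a) trajectory list \<Rightarrow> 'v \<Rightarrow> real) \<Rightarrow> 'v \<Rightarrow> ('s, 'a) policy \<Rightarrow> real" where
  "upper_objective P \<rho> I H l x \<pi> =
     measure_pmf.expectation (replicate_pmf I (traj_pmf P \<rho> H \<pi>)) (\<lambda>D. l D x)"

definition hyper_objective :: "('s::finite, 'a::finite) kernel \<Rightarrow> real \<Rightarrow> real \<Rightarrow> 's pmf \<Rightarrow>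
    ('v \<Rightarrow> 's \<Rightarrow> 'a \<Rightarrow> real) \<Rightarrow> ('s, 'a) kernel \<Rightarrow> 's pmf \<Rightarrow> nat \<Rightarrow> nat \<Rightarrow>
    (('s, 'a) trajectory list \<Rightarrow> 'v \<Rightarrow> real) \<Rightarrow> 'v \<Rightarrow> real" where
  "hyper_objective P \<gamma> \<tau> \<rho> r Pbar \<rho>bar I H l x =
     upper_objective Pbar \<rho>bar I H l x (optimal_policy P \<gamma> \<tau> \<rho> (r x))"

end

theory Submission
  imports Defs
begin

text \<open>
  By Gibbs' variational principle the optimal policy is the softmax of \<open>(Q - V) / \<tau>\<close>, where \<open>V\<close> is
  the fixed point of the soft Bellman operator, so \<open>\<nabla> log \<pi>\<close> is \<open>(\<nabla>Q - \<nabla>V) / \<tau>\<close>, and \<open>\<nabla>V\<close>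
  solves the linear Bellman equation with reward \<open>\<nabla>r\<close>. Discounting gives
  \<open>\<parallel>\<nabla>V\<parallel>, \<parallel>\<nabla>Q\<parallel> \<le> C\<^sub>r\<^sub>x / (1 - \<gamma>)\<close>. Both the policy and the law of the trajectory tuples
  have the form \<open>w\<^sub>d(x) = c\<^sub>d exp (\<Theta>\<^sub>d(x))\<close> with \<open>\<parallel>\<nabla>\<Theta>\<^sub>d\<parallel> \<le> G\<close> and total mass \<open>1\<close>, whence
  \<open>\<Sum>\<bar>w\<^sub>d(x\<^sub>1) - w\<^sub>d(x\<^sub>2)\<bar> \<le> G \<parallel>x\<^sub>1 - x\<^sub>2\<parallel>\<close>. This makes \<open>\<nabla>V\<close> Lipschitz, and then also
  \<open>\<nabla>\<phi> = \<Sum> w\<^sub>d (\<nabla>l\<^sub>d + l\<^sub>d \<nabla>\<Theta>\<^sub>d)\<close>. The constants obtained have \<open>2 C\<^sub>r\<^sub>x / (\<tau> (1 - \<gamma>))\<close> in place of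
  the larger \<open>L\<^sub>\<pi> \<surd>|\<A>|\<close>.
\<close>

section \<open>Discounted values as solutions of the Bellman equation\<close>


text \<open>Only the one-time marginals of the process enter the value, since each summand of the
  discounted reward depends on a single coordinate.\<close>

primrec state_action_law :: "('s, 'a) kernel \<Rightarrow> ('s, 'a) policy \<Rightarrow> 's \<Rightarrow> nat \<Rightarrow> ('s \<times> 'a) pmf" where
  "state_action_law P \<pi> s 0 = act \<pi> s"
| "state_action_law P \<pi> s (Suc t) =
     bind_pmf (state_action_law P \<pi> s t) (\<lambda>z. bind_pmf (P (fst z) (snd z)) (act \<pi>))"

text \<open>The marginal at time \<open>t\<close> of the limit measure is the last coordinate of the
  finite-path law \<open>IT.C 0 (Suc t)\<close>. Extending a path by one step uses only its last
  pair, so these marginals satisfy the recursion of \<open>state_action_law\<close>.\<close>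

lemma distr_mdp_law:
  fixes P :: "('s::finite, 'a::finite) kernel"
  shows "distr (mdp_law P \<pi> s) (count_space UNIV) (\<lambda>\<omega>. \<omega> t) = measure_pmf (state_action_law P \<pi> s t)"
proof -
  let ?M = "\<lambda>_::nat. count_space (UNIV :: ('s \<times> 'a) set)"
  let ?u = "\<lambda>_::nat. undefined :: 's \<times> 'a"
  interpret IT: Ionescu_Tulcea "mdp_step P \<pi> s" ?M
    by (rule Ionescu_Tulcea_mdp_step)
  have u: "?u \<in> space (PiM {0..<0} ?M)"
    by (simp add: space_PiM)
  have C: "distr (IT.C 0 (Suc t) ?u) (count_space UNIV) (\<lambda>\<omega>. \<omega> t) = measure_pmf (state_action_law P \<pi> s t)" for t
  proof -
    have "distr (IT.C 0 (Suc t) ?u) (count_space UNIV) (\<lambda>\<omega>. \<omega> t)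
       = IT.C 0 t ?u \<bind> (\<lambda>\<omega>. distr (IT.eP t \<omega>) (count_space UNIV) (\<lambda>\<omega>. \<omega> t))" for t
      unfolding IT.C.simps
      by (subst distr_bind[where K="PiM {0..<Suc t} ?M"])
        (use IT.prob_space_C[OF u, of t] in
          \<open>auto simp: prob_space.not_empty measurable_cong_sets[OF IT.sets_C[OF u] refl]
            intro!: measurable_component_singleton\<close>)
    \<comment> \<open>\<open>IT.eP t \<omega>\<close> appends a coordinate drawn from
      \<open>mdp_step\<close> to the path; projecting onto that coordinate recovers the
      kernel.\<close>
    also have "IT.C 0 t ?u \<bind> (\<lambda>\<omega>. distr (IT.eP t \<omega>) (count_space UNIV) (\<lambda>\<omega>. \<omega> t))
        = IT.C 0 t ?u \<bind> mdp_step P \<pi> s t" for t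
    proof (rule bind_cong_All, safe)
      fix \<omega> assume "\<omega> \<in> space (IT.C 0 t ?u)"
      then have \<omega>: "\<omega> \<in> space (PiM {0..<t} ?M)"
        using IT.space_C[OF u, of t] by simp
      have "distr (IT.eP t \<omega>) (count_space UNIV) (\<lambda>\<omega>. \<omega> t) = distr (mdp_step P \<pi> s t \<omega>) (count_space UNIV) (\<lambda>x. x)"
        unfolding IT.eP_def
        by (subst distr_distr)
          (use \<omega> in \<open>auto simp: comp_def space_PiM PiE_iff extensional_def
            intro!: measurable_component_singleton measurable_fun_upd[where J="{0..<t}"]
            simp: measurable_cong_sets[OF IT.sets_P[OF \<omega>] refl]\<close>)
      also have "\<dots> = mdp_step P \<pi> s t \<omega>"
        by (rule distr_id2) (simp add: IT.sets_P[OF \<omega>])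
      finally show "distr (IT.eP t \<omega>) (count_space UNIV) (\<lambda>\<omega>. \<omega> t) = mdp_step P \<pi> s t \<omega>" .
    qed
    finally have step: "distr (IT.C 0 (Suc t) ?u) (count_space UNIV) (\<lambda>\<omega>. \<omega> t) =
        IT.C 0 t ?u \<bind> mdp_step P \<pi> s t" for t .
    show ?thesis
    proof (induction t)
      case 0
      show ?case
        unfolding step
        by (simp only: IT.C.simps bind_return[OF IT.P[of 0] u] mdp_step.simps state_action_law.simps add_0)
    next
      case (Suc t)
      let ?K = "\<lambda>z. measure_pmf (bind_pmf (P (fst z) (snd z)) (act \<pi>))"
      have "IT.C 0 (Suc t) ?u \<bind> mdp_step P \<pi> s (Suc t) = IT.C 0 (Suc t) ?u \<bind> (\<lambda>\<omega>. ?K (\<omega> t))"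
        by (simp only: mdp_step.simps(2)[abs_def])
      also have "\<dots> = distr (IT.C 0 (Suc t) ?u) (count_space UNIV) (\<lambda>\<omega>. \<omega> t) \<bind> ?K"
        by (subst bind_distr[where K="count_space UNIV"])
          (use IT.prob_space_C[OF u, of "Suc t"] in
            \<open>auto simp: prob_space.not_empty measurable_cong_sets[OF IT.sets_C[OF u] refl]
              measure_pmf_in_subprob_algebra
            intro!: measurable_component_singleton simp del: IT.C.simps\<close>)
      also have "\<dots> = measure_pmf (state_action_law P \<pi> s t) \<bind> ?K"
        by (simp only: Suc.IH)
      finally show ?case
        unfolding step by (simp add: measure_pmf_bind)
    qed
  qed
  \<comment> \<open>Paths on \<open>{0..<Suc t}\<close> are the shortest ones that contain the
    coordinate \<open>t\<close>.\<close>
  have up: "IT.up_to {t} = Suc t"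
    unfolding IT.up_to_def by (rule Least_equality) (auto simp: not_less_eq_eq[symmetric])
  have "distr (mdp_law P \<pi> s) (count_space UNIV) (\<lambda>\<omega>. \<omega> t)
     = distr (distr IT.PF.lim (PiM {t} ?M) (\<lambda>\<omega>. restrict \<omega> {t})) (count_space UNIV) (\<lambda>\<omega>. \<omega> t)"
    unfolding mdp_law_def
    by (subst distr_distr) (auto simp: comp_def measurable_cong_sets[OF IT.PF.sets_lim refl]
        intro!: measurable_component_singleton measurable_restrict)
  also have "\<dots> = distr (IT.C 0 (Suc t) ?u) (count_space UNIV) (\<lambda>\<omega>. \<omega> t)"
    unfolding IT.distr_lim[OF finite.insertI[OF finite.emptyI]] IT.CI_def up
    by (subst distr_distr) (auto simp: comp_def measurable_cong_sets[OF IT.sets_C[OF u] refl]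
        intro!: measurable_component_singleton measurable_restrict simp del: IT.C.simps)
  finally show ?thesis
    by (simp only: C)
qed

lemma measurable_mdp_law:
  fixes P :: "('s::finite, 'a::finite) kernel"
  shows "(\<lambda>\<omega>. \<omega> t) \<in> measurable (mdp_law P \<pi> s) (count_space UNIV)"
proof -
  interpret IT: Ionescu_Tulcea "mdp_step P \<pi> s" "\<lambda>_. count_space UNIV"
    by (rule Ionescu_Tulcea_mdp_step)
  show ?thesis
    unfolding mdp_law_def measurable_cong_sets[OF IT.PF.sets_lim refl]
    by (rule measurable_component_singleton) simp
qed

lemma prob_space_mdp_law:
  fixes P :: "('s::finite, 'a::finite) kernel"
  shows "prob_space (mdp_law P \<pi> s)"
  by (rule prob_space_distrD[OF measurable_mdp_law[of 0]])
    (simp add: distr_mdp_law measure_pmf.prob_space_axioms del: state_action_law.simps)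

lemma integral_mdp_law:
  fixes P :: "('s::finite, 'a::finite) kernel" and g :: "'s \<times> 'a \<Rightarrow> real"
  shows "(\<integral>\<omega>. g (\<omega> t) \<partial>mdp_law P \<pi> s) = measure_pmf.expectation (state_action_law P \<pi> s t) g"
  by (subst distr_mdp_law[symmetric], subst integral_distr[OF measurable_mdp_law]) simp_all

text \<open>The recursion of \<^const>\<open>state_action_law\<close> appends transitions at the end of the path; the Bellman
  equation needs the first transition split off instead.\<close>

lemma state_action_law_Suc:
  "state_action_law P \<pi> s (Suc t) =
     bind_pmf (act \<pi> s) (\<lambda>z. bind_pmf (P (fst z) (snd z)) (\<lambda>s'. state_action_law P \<pi> s' t))"
  by (induction t) (simp_all add: bind_assoc_pmf)

lemma expectation_bind_finite:
  fixes p :: "'b::finite pmf" and f :: "'b \<Rightarrow> 'c::finite pmf" and g :: "'c \<Rightarrow> real"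
  shows "measure_pmf.expectation (bind_pmf p f) g = (\<Sum>b\<in>UNIV. pmf p b * measure_pmf.expectation (f b) g)"
  by (subst pmf_expectation_bind[where A=UNIV]) auto

lemma expectation_act:
  fixes \<pi> :: "('s, 'a::finite) policy" and g :: "'s \<times> 'a \<Rightarrow> real"
  shows "measure_pmf.expectation (act \<pi> s) g = (\<Sum>a\<in>UNIV. pmf (\<pi> s) a * g (s, a))"
  unfolding act_def by (subst integral_map_pmf, subst integral_measure_pmf[where A=UNIV]) auto

text \<open>The reward takes finitely many values, so a geometric bound allows the integral and the
  series to be exchanged. The term at time 0 gives the immediate reward and entropy; by
  \<open>state_action_law_Suc\<close> the tail is the discounted average of the values at the next
  state.\<close>

lemma soft_value_Bellman:
  fixes P :: "('s::finite, 'a::finite) kernel"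
  assumes "0 < \<gamma>" "\<gamma> < 1"
  shows "soft_value P \<gamma> \<tau> R \<pi> s =
    (\<Sum>a\<in>UNIV. pmf (\<pi> s) a * (R s a + \<gamma> * (\<Sum>s'\<in>UNIV. pmf (P s a) s' * soft_value P \<gamma> \<tau> R \<pi> s')))
      + \<tau> * policy_entropy (\<pi> s)"
proof -
  define g where "g = (\<lambda>z. R (fst z) (snd z) + \<tau> * policy_entropy (\<pi> (fst z)))"
  define u where "u s t = measure_pmf.expectation (state_action_law P \<pi> s t) g" for s t
  define B where "B = Max (range (\<lambda>z. \<bar>g z\<bar>))"
  have gB: "\<bar>g z\<bar> \<le> B" for z
    unfolding B_def by (rule Max_ge) auto
  have geo: "summable (\<lambda>t. \<gamma> ^ t * B)"
    using assms by (intro summable_mult2 summable_geometric) simp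
  have val: "(\<lambda>t. \<gamma> ^ t * u s t) sums soft_value P \<gamma> \<tau> R \<pi> s" for s
  proof -
    interpret prob_space "mdp_law P \<pi> s"
      by (rule prob_space_mdp_law)
    have meas: "(\<lambda>\<omega>. g (\<omega> t)) \<in> borel_measurable (mdp_law P \<pi> s)" for t
      by (rule measurable_compose[OF measurable_mdp_law]) simp
    have int: "integrable (mdp_law P \<pi> s) (\<lambda>\<omega>. \<gamma> ^ t * g (\<omega> t))" for t
      by (intro integrable_mult_right integrable_const_bound[where B=B] meas) (simp add: gB)
    have bnd: "norm (\<gamma> ^ t * g z) \<le> \<gamma> ^ t * B" for t z
      using assms gB[of z] by (simp add: abs_mult mult_left_mono)
    have "(\<lambda>t. \<integral>\<omega>. \<gamma> ^ t * g (\<omega> t) \<partial>mdp_law P \<pi> s) sums (\<integral>\<omega>. (\<Sum>t. \<gamma> ^ t * g (\<omega> t)) \<partial>mdp_law P \<pi> s)"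
    proof (rule sums_integral[OF int])
      show "AE \<omega> in mdp_law P \<pi> s. summable (\<lambda>t. norm (\<gamma> ^ t * g (\<omega> t)))"
        using bnd by (intro AE_I2 summable_comparison_test'[OF geo]) auto
      have "(\<integral>\<omega>. norm (\<gamma> ^ t * g (\<omega> t)) \<partial>mdp_law P \<pi> s) \<le> \<gamma> ^ t * B" for t
        by (intro integral_le_const integrable_norm int AE_I2 bnd)
      then show "summable (\<lambda>t. \<integral>\<omega>. norm (\<gamma> ^ t * g (\<omega> t)) \<partial>mdp_law P \<pi> s)"
        by (intro summable_comparison_test'[OF geo]) auto
    qed
    then show ?thesis
      unfolding integral_mult_right_zero integral_mdp_law u_def[symmetric]
      by (simp add: soft_value_def g_def)
  qed
  have u0: "u s 0 = (\<Sum>a\<in>UNIV. pmf (\<pi> s) a * R s a) + \<tau> * policy_entropy (\<pi> s)"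
    by (simp add: u_def expectation_act g_def distrib_left sum.distrib sum_pmf_eq_1 flip: sum_distrib_right)
  have uS: "u s (Suc t) = (\<Sum>a\<in>UNIV. pmf (\<pi> s) a * (\<Sum>s'\<in>UNIV. pmf (P s a) s' * u s' t))" for t
    unfolding u_def state_action_law_Suc act_def bind_map_pmf by (simp add: expectation_bind_finite)
  \<comment> \<open>Averaging the value series over the first transition, with one factor
    \<open>\<gamma>\<close> moved inside, produces the terms with index
    \<open>Suc t\<close>.\<close>
  have "(\<lambda>t. \<Sum>a\<in>UNIV. pmf (\<pi> s) a * (\<Sum>s'\<in>UNIV. pmf (P s a) s' * (\<gamma> * (\<gamma> ^ t * u s' t)))) sums
     (\<Sum>a\<in>UNIV. pmf (\<pi> s) a * (\<Sum>s'\<in>UNIV. pmf (P s a) s' * (\<gamma> * soft_value P \<gamma> \<tau> R \<pi> s')))"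
    by (intro sums_sum sums_mult val)
  then have "(\<lambda>t. \<gamma> ^ Suc t * u s (Suc t)) sums
     (\<Sum>a\<in>UNIV. pmf (\<pi> s) a * (\<Sum>s'\<in>UNIV. pmf (P s a) s' * (\<gamma> * soft_value P \<gamma> \<tau> R \<pi> s')))"
    by (simp add: uS sum_distrib_left mult_ac)
  then have "(\<lambda>t. \<gamma> ^ t * u s t) sums
     ((\<Sum>a\<in>UNIV. pmf (\<pi> s) a * (\<Sum>s'\<in>UNIV. pmf (P s a) s' * (\<gamma> * soft_value P \<gamma> \<tau> R \<pi> s'))) + u s 0)"
    by (subst (asm) sums_Suc_iff) simp
  from sums_unique2[OF val this] show ?thesis
    by (simp add: u0 distrib_left sum.distrib sum_distrib_left mult_ac)
qed

section \<open>The optimal policy as a softmax\<close>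


text \<open>The maximum \<open>M\<close> of \<open>e\<close> over the finite state set is attained,
  so the step applied with \<open>B = M\<close> reads
  \<open>M \<le> c + \<gamma> * M\<close>.\<close>

lemma discounted_max_bound:
  fixes e :: "'s::finite \<Rightarrow> real"
  assumes "\<gamma> < 1" and step: "\<And>B s. (\<And>s. e s \<le> B) \<Longrightarrow> e s \<le> c + \<gamma> * B"
  shows "e s \<le> c / (1 - \<gamma>)"
proof -
  have "e s \<le> Max (range e)" for s
    by (rule Max_ge) auto
  moreover have "Max (range e) \<in> range e"
    by (rule Max_in) auto
  ultimately have "Max (range e) \<le> c + \<gamma> * Max (range e)"
    using step[of "Max (range e)"] by auto
  then have "Max (range e) \<le> c / (1 - \<gamma>)"
    using \<open>\<gamma> < 1\<close> by (simp add: pos_le_divide_eq algebra_simps)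
  with \<open>e s \<le> Max (range e)\<close> show ?thesis
    by simp
qed

text \<open>Banach's fixed point theorem for the sup norm over states, with that norm expressed by a
  common bound \<open>B\<close>. Values in a Banach space cover both value functions and their
  gradients.\<close>

lemma contraction_fixed_point:
  fixes T :: "('s::finite \<Rightarrow> 'v::banach) \<Rightarrow> 's \<Rightarrow> 'v"
  assumes "0 \<le> \<gamma>" "\<gamma> < 1"
    and contr: "\<And>f g B s. (\<And>s. norm (f s - g s) \<le> B) \<Longrightarrow> norm (T f s - T g s) \<le> \<gamma> * B"
  shows "\<exists>f. T f = f"
proof -
  define u where "u t = (T ^^ t) (\<lambda>_. 0)" for t
  have uS: "u (Suc t) = T (u t)" for t
    by (simp add: u_def)
  define B where "B = Max (range (\<lambda>s. norm (u 1 s - u 0 s)))"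
  have B: "norm (u 1 s - u 0 s) \<le> B" for s
    unfolding B_def by (rule Max_ge) auto
  have diff: "norm (u (Suc t) s - u t s) \<le> \<gamma> ^ t * B" for t s
  proof (induction t arbitrary: s)
    case 0
    show ?case using B by simp
  next
    case (Suc t)
    show ?case
      using contr[of "u (Suc t)" "u t" "\<gamma> ^ t * B" s] Suc by (simp add: uS mult.assoc)
  qed
  have geo: "summable (\<lambda>t. \<gamma> ^ t * B)"
    using assms by (intro summable_mult2 summable_geometric) simp
  have "convergent (\<lambda>t. u t s)" for s
  proof -
    have "summable (\<lambda>t. u (Suc t) s - u t s)"
      by (rule summable_comparison_test'[OF geo]) (rule diff)
    then have "convergent (\<lambda>n. \<Sum>t<n. u (Suc t) s - u t s)"
      by (simp add: summable_iff_convergent)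
    then have "convergent (\<lambda>n. u n s - u 0 s)"
      by (simp add: sum_lessThan_telescope[of "\<lambda>t. u t s"])
    from convergent_add[OF this convergent_const[of "u 0 s"]] show ?thesis
      by simp
  qed
  then obtain f where f: "(\<lambda>t. u t s) \<longlonglongrightarrow> f s" for s
    unfolding convergent_def by metis
  have "T f s = f s" for s
  proof -
    have lim: "(\<lambda>t. u t s - f s) \<longlonglongrightarrow> 0" for s
      using f[of s] by (simp add: LIM_zero_iff)
    \<comment> \<open>The finite sum of all pointwise distances serves as a bound \<open>B\<close>
      that tends to 0, so \<open>T\<close> is continuous along the iterates.\<close>
    have "(\<lambda>t. u (Suc t) s - T f s) \<longlonglongrightarrow> 0"
    proof (rule Lim_null_comparison)
      show "\<forall>\<^sub>F t in sequentially. norm (u (Suc t) s - T f s) \<le> \<gamma> * (\<Sum>s\<in>UNIV. norm (u t s - f s))"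
        unfolding uS by (intro always_eventually allI contr member_le_sum) auto
      show "(\<lambda>t. \<gamma> * (\<Sum>s\<in>UNIV. norm (u t s - f s))) \<longlonglongrightarrow> 0"
        by (intro tendsto_mult_right_zero tendsto_null_sum tendsto_norm_zero lim)
    qed
    then have "(\<lambda>t. u (Suc t) s) \<longlonglongrightarrow> T f s"
      by (simp add: LIM_zero_iff)
    moreover have "(\<lambda>t. u (Suc t) s) \<longlonglongrightarrow> f s"
      by (rule LIMSEQ_Suc[OF f])
    ultimately show ?thesis
      by (rule LIMSEQ_unique)
  qed
  then show ?thesis by blast
qed

section \<open>Averages, log-sum-exp and Gibbs' variational principle\<close>

lemma norm_pmf_average_le:
  fixes f :: "'b::finite \<Rightarrow> 'v::real_normed_vector"
  assumes "\<And>b. norm (f b) \<le> B"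
  shows "norm (\<Sum>b\<in>UNIV. pmf p b *\<^sub>R f b) \<le> B"
proof -
  have "norm (\<Sum>b\<in>UNIV. pmf p b *\<^sub>R f b) \<le> (\<Sum>b\<in>UNIV. pmf p b * B)"
    by (rule sum_norm_le) (simp add: assms mult_left_mono)
  also have "\<dots> = B"
    by (simp add: sum_pmf_eq_1 flip: sum_distrib_right)
  finally show ?thesis .
qed

lemma abs_pmf_average_le:
  fixes f :: "'b::finite \<Rightarrow> real"
  assumes "\<And>b. \<bar>f b\<bar> \<le> B"
  shows "\<bar>\<Sum>b\<in>UNIV. pmf p b * f b\<bar> \<le> B"
  using norm_pmf_average_le[of f B p] assms by simp

text \<open>\<open>\<tau>\<close> times the log-partition function: a smoothed maximum, and the
  convex conjugate of the scaled negative entropy.\<close>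

definition log_sum_exp :: "real \<Rightarrow> ('a::finite \<Rightarrow> real) \<Rightarrow> real" where
  "log_sum_exp \<tau> q = \<tau> * ln (\<Sum>a\<in>UNIV. exp (q a / \<tau>))"

text \<open>The normalisation sits inside the exponent, so the log-probability is visible as a
  difference divided by \<open>\<tau>\<close>.\<close>

definition softmax :: "real \<Rightarrow> ('a::finite \<Rightarrow> real) \<Rightarrow> 'a pmf" where
  "softmax \<tau> q = embed_pmf (\<lambda>a. exp ((q a - log_sum_exp \<tau> q) / \<tau>))"

lemma sum_exp_pos: "0 < (\<Sum>a\<in>UNIV. exp (q (a::'a::finite) :: real))"
  by (rule sum_pos) auto

lemma pmf_softmax:
  fixes q :: "'a::finite \<Rightarrow> real"
  assumes "0 < \<tau>"
  shows "pmf (softmax \<tau> q) a = exp ((q a - log_sum_exp \<tau> q) / \<tau>)"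
  unfolding softmax_def
proof (rule pmf_embed_pmf)
  let ?Z = "\<Sum>a\<in>UNIV. exp (q a / \<tau>)"
  have "exp ((q a - log_sum_exp \<tau> q) / \<tau>) = exp (q a / \<tau>) / ?Z" for a
    using assms sum_exp_pos[of "\<lambda>a. q a / \<tau>"] by (simp add: log_sum_exp_def diff_divide_distrib exp_diff)
  then have "(\<Sum>a\<in>UNIV. exp ((q a - log_sum_exp \<tau> q) / \<tau>)) = 1"
    using sum_exp_pos[of "\<lambda>a. q a / \<tau>"] by (simp flip: sum_divide_distrib)
  then show "(\<integral>\<^sup>+a. ennreal (exp ((q a - log_sum_exp \<tau> q) / \<tau>)) \<partial>count_space UNIV) = 1"
    by (simp add: nn_integral_count_space_finite sum_ennreal)
qed simp

text \<open>Gibbs' inequality and its equality case. Since \<open>p\<close> and \<open>q\<close>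
  have the same mass, each summand may be corrected by \<open>pmf p a - pmf q a\<close>; it then
  becomes \<open>pmf p a * (y - 1 - ln y)\<close> with \<open>y = pmf q a / pmf p a\<close>, and
  \<open>ln y \<le> y - 1\<close> is strict unless \<open>y = 1\<close>.\<close>

lemma relative_entropy_nonneg:
  fixes p q :: "'a::finite pmf"
  assumes "\<And>a. 0 < pmf q a"
  shows "0 \<le> (\<Sum>a\<in>UNIV. pmf p a * (ln (pmf p a) - ln (pmf q a)))" (is "0 \<le> ?S")
    and "(\<Sum>a\<in>UNIV. pmf p a * (ln (pmf p a) - ln (pmf q a))) = 0 \<Longrightarrow> p = q"
proof -
  define d where "d a = pmf p a * (ln (pmf p a) - ln (pmf q a)) - (pmf p a - pmf q a)" for a
  have d: "0 \<le> d a \<and> (d a = 0 \<longrightarrow> pmf p a = pmf q a)" for a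
  proof (cases "pmf p a = 0")
    case True
    \<comment> \<open>Here \<open>d a = pmf q a\<close> is positive, so the equality case cannot
      occur.\<close>
    then show ?thesis
      using assms[of a] by (simp add: d_def)
  next
    case False
    then have p: "0 < pmf p a"
      by (simp add: order_less_le)
    define y where "y = pmf q a / pmf p a"
    have "0 < y"
      using assms[of a] p by (simp add: y_def)
    moreover have "d a = pmf p a * (y - 1 - ln y)"
      using p assms[of a] by (simp add: d_def y_def ln_div algebra_simps)
    moreover have "y = 1 \<Longrightarrow> pmf p a = pmf q a"
      using p by (simp add: y_def)
    ultimately show ?thesis
      using p ln_le_minus_one[of y] ln_eq_minus_one[of y] by auto
  qed
  have S: "?S = (\<Sum>a\<in>UNIV. d a)"
    by (simp add: d_def sum_subtractf sum_pmf_eq_1)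
  show "0 \<le> ?S"
    unfolding S by (rule sum_nonneg) (simp add: d)
  assume "?S = 0"
  then have "d a = 0" for a
    unfolding S by (subst (asm) sum_nonneg_eq_0_iff) (simp_all add: d)
  then show "p = q"
    using d by (intro pmf_eqI) auto
qed

text \<open>The log-probabilities of the softmax are
  \<open>(q a - log_sum_exp \<tau> q) / \<tau>\<close>, so \<open>\<tau>\<close> times the relative
  entropy of \<open>p\<close> to the softmax is exactly the gap in the variational
  principle.\<close>

lemma log_sum_exp_eq:
  fixes q :: "'a::finite \<Rightarrow> real"
  assumes "0 < \<tau>"
  shows "log_sum_exp \<tau> q = (\<Sum>a\<in>UNIV. pmf p a * q a) + \<tau> * policy_entropy p
     + \<tau> * (\<Sum>a\<in>UNIV. pmf p a * (ln (pmf p a) - ln (pmf (softmax \<tau> q) a)))"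
proof -
  have "\<tau> * (pmf p a * (ln (pmf p a) - ln (pmf (softmax \<tau> q) a))) =
      \<tau> * (pmf p a * ln (pmf p a)) - pmf p a * q a + pmf p a * log_sum_exp \<tau> q" for a
    using assms by (simp add: pmf_softmax field_simps)
  then have "\<tau> * (\<Sum>a\<in>UNIV. pmf p a * (ln (pmf p a) - ln (pmf (softmax \<tau> q) a))) =
      (\<Sum>a\<in>UNIV. \<tau> * (pmf p a * ln (pmf p a)) - pmf p a * q a + pmf p a * log_sum_exp \<tau> q)"
    by (simp add: sum_distrib_left)
  also have "\<dots> = \<tau> * (\<Sum>a\<in>UNIV. pmf p a * ln (pmf p a)) - (\<Sum>a\<in>UNIV. pmf p a * q a) + log_sum_exp \<tau> q"
    by (simp add: sum.distrib sum_subtractf sum_pmf_eq_1 flip: sum_distrib_left sum_distrib_right)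
  finally show ?thesis
    by (simp add: policy_entropy_def)
qed

lemma softmax_pos: "0 < \<tau> \<Longrightarrow> 0 < pmf (softmax \<tau> q) a"
  by (simp add: pmf_softmax)

lemma log_sum_exp_ge:
  fixes q :: "'a::finite \<Rightarrow> real"
  assumes "0 < \<tau>"
  shows "(\<Sum>a\<in>UNIV. pmf p a * q a) + \<tau> * policy_entropy p \<le> log_sum_exp \<tau> q"
  using log_sum_exp_eq[OF assms, of q p] assms
    relative_entropy_nonneg(1)[of "softmax \<tau> q" p, OF softmax_pos[OF assms]] by simp

lemma log_sum_exp_softmax:
  fixes q :: "'a::finite \<Rightarrow> real"
  assumes "0 < \<tau>"
  shows "log_sum_exp \<tau> q =
    (\<Sum>a\<in>UNIV. pmf (softmax \<tau> q) a * q a) + \<tau> * policy_entropy (softmax \<tau> q)"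
  using log_sum_exp_eq[OF assms, of q "softmax \<tau> q"] by simp

text \<open>Subgradient inequality: the softmax of \<open>q\<close> is optimal for \<open>q\<close>
  and a competitor for \<open>q'\<close>, and its entropy cancels.\<close>

lemma log_sum_exp_diff_ge:
  fixes q :: "'a::finite \<Rightarrow> real"
  assumes "0 < \<tau>"
  shows "(\<Sum>a\<in>UNIV. pmf (softmax \<tau> q) a * (q' a - q a)) \<le> log_sum_exp \<tau> q' - log_sum_exp \<tau> q"
  using log_sum_exp_ge[OF assms, of "softmax \<tau> q" q'] log_sum_exp_softmax[OF assms, of q]
  by (simp add: right_diff_distrib sum_subtractf)

lemma log_sum_exp_nonexpansive:
  fixes q :: "'a::finite \<Rightarrow> real"
  assumes "0 < \<tau>" and le: "\<And>a. \<bar>q' a - q a\<bar> \<le> B"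
  shows "\<bar>log_sum_exp \<tau> q' - log_sum_exp \<tau> q\<bar> \<le> B"
proof -
  have "\<bar>\<Sum>a\<in>UNIV. pmf (softmax \<tau> q) a * (q' a - q a)\<bar> \<le> B"
    using le by (rule abs_pmf_average_le)
  moreover have "\<bar>\<Sum>a\<in>UNIV. pmf (softmax \<tau> q') a * (q a - q' a)\<bar> \<le> B"
    using le by (intro abs_pmf_average_le) (simp add: abs_minus_commute)
  ultimately show ?thesis
    using log_sum_exp_diff_ge[OF assms(1), of q q'] log_sum_exp_diff_ge[OF assms(1), of q' q]
    by linarith
qed

text \<open>The values lie in a vector space because the same operator acts on real values and on
  their gradients.\<close>

definition action_value :: "('s::finite, 'a) kernel \<Rightarrow> real \<Rightarrow> ('s \<Rightarrow> 'a \<Rightarrow> 'v::real_vector) \<Rightarrow>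
    ('s \<Rightarrow> 'v) \<Rightarrow> 's \<Rightarrow> 'a \<Rightarrow> 'v" where
  "action_value P \<gamma> R V s a = R s a + \<gamma> *\<^sub>R (\<Sum>s'\<in>UNIV. pmf (P s a) s' *\<^sub>R V s')"

lemma action_value_diff:
  "action_value P \<gamma> R V s a - action_value P \<gamma> R' V' s a =
     action_value P \<gamma> (\<lambda>s a. R s a - R' s a) (\<lambda>s. V s - V' s) s a"
  by (simp add: action_value_def sum_subtractf scaleR_diff_right)

lemma norm_action_value_le:
  fixes R :: "'s::finite \<Rightarrow> 'a \<Rightarrow> 'v::real_normed_vector"
  assumes "0 \<le> \<gamma>" "norm (R s a) \<le> b" "\<And>s. norm (V s) \<le> B"
  shows "norm (action_value P \<gamma> R V s a) \<le> b + \<gamma> * B"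
  unfolding action_value_def
  by (rule order_trans[OF norm_triangle_ineq add_mono])
    (use assms norm_pmf_average_le[of V B "P s a"] in \<open>auto intro: mult_left_mono\<close>)

text \<open>A fixed point of the soft Bellman operator; existence is established in
  \<open>opt_value_eq\<close>.\<close>

definition opt_value :: "('s::finite, 'a::finite) kernel \<Rightarrow> real \<Rightarrow> real \<Rightarrow> ('s \<Rightarrow> 'a \<Rightarrow> real) \<Rightarrow> 's \<Rightarrow> real" where
  "opt_value P \<gamma> \<tau> R = (SOME V. \<forall>s. V s = log_sum_exp \<tau> (action_value P \<gamma> R V s))"

section \<open>Soft Bellman equation and optimality of the softmax policy\<close>

locale soft_mdp =
  fixes P :: "('s::finite, 'a::finite) kernel" and \<gamma> \<tau> :: real
  assumes \<gamma>_pos: "0 < \<gamma>" and \<gamma>_less_1: "\<gamma> < 1" and \<tau>_pos: "0 < \<tau>"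
begin

text \<open>Rewards cancel in differences of action values, so \<open>action_value\<close> contracts
  by \<open>\<gamma>\<close>, and log-sum-exp is nonexpansive.\<close>

lemma opt_value_eq: "opt_value P \<gamma> \<tau> R s = log_sum_exp \<tau> (action_value P \<gamma> R (opt_value P \<gamma> \<tau> R) s)"
proof -
  have "\<exists>V. (\<lambda>s. log_sum_exp \<tau> (action_value P \<gamma> R V s)) = V"
  proof (rule contraction_fixed_point)
    fix V W :: "'s \<Rightarrow> real" and B s
    assume "\<And>s. norm (V s - W s) \<le> B"
    then have "norm (action_value P \<gamma> R V s a - action_value P \<gamma> R W s a) \<le> 0 + \<gamma> * B" for a
      unfolding action_value_diff using \<gamma>_pos by (intro norm_action_value_le) auto
    then show "norm (log_sum_exp \<tau> (action_value P \<gamma> R V s) - log_sum_exp \<tau> (action_value P \<gamma> R W s)) \<le> \<gamma> * B"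
      by (simp add: log_sum_exp_nonexpansive[OF \<tau>_pos])
  qed (use \<gamma>_pos \<gamma>_less_1 in auto)
  then have "\<exists>V. \<forall>s. V s = log_sum_exp \<tau> (action_value P \<gamma> R V s)"
    by metis
  from someI_ex[OF this] show ?thesis
    unfolding opt_value_def by blast
qed

definition opt_policy :: "('s \<Rightarrow> 'a \<Rightarrow> real) \<Rightarrow> ('s, 'a) policy" where
  "opt_policy R s = softmax \<tau> (action_value P \<gamma> R (opt_value P \<gamma> \<tau> R) s)"

lemma pmf_opt_policy:
  "pmf (opt_policy R s) a =
    exp ((action_value P \<gamma> R (opt_value P \<gamma> \<tau> R) s a - opt_value P \<gamma> \<tau> R s) / \<tau>)"
  by (simp add: opt_policy_def pmf_softmax[OF \<tau>_pos] flip: opt_value_eq)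

lemma opt_policy_pos: "0 < pmf (opt_policy R s) a"
  by (simp add: pmf_opt_policy)

text \<open>Performance difference identity: the Bellman equation for \<open>\<pi>\<close> is
  subtracted from \<open>log_sum_exp_eq\<close> with \<open>p = \<pi> s\<close>. The reward and
  entropy terms cancel and the relative entropy remains.\<close>

lemma opt_value_minus_soft_value:
  "opt_value P \<gamma> \<tau> R s - soft_value P \<gamma> \<tau> R \<pi> s =
    \<gamma> * (\<Sum>a\<in>UNIV. pmf (\<pi> s) a * (\<Sum>s'\<in>UNIV. pmf (P s a) s' *
        (opt_value P \<gamma> \<tau> R s' - soft_value P \<gamma> \<tau> R \<pi> s')))
    + \<tau> * (\<Sum>a\<in>UNIV. pmf (\<pi> s) a * (ln (pmf (\<pi> s) a) - ln (pmf (opt_policy R s) a)))"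
proof -
  let ?V = "opt_value P \<gamma> \<tau> R" and ?W = "soft_value P \<gamma> \<tau> R \<pi>"
  have "?V s = (\<Sum>a\<in>UNIV. pmf (\<pi> s) a * action_value P \<gamma> R ?V s a) + \<tau> * policy_entropy (\<pi> s)
     + \<tau> * (\<Sum>a\<in>UNIV. pmf (\<pi> s) a * (ln (pmf (\<pi> s) a) - ln (pmf (opt_policy R s) a)))"
    unfolding opt_policy_def by (subst opt_value_eq) (rule log_sum_exp_eq[OF \<tau>_pos])
  moreover have "?W s = (\<Sum>a\<in>UNIV. pmf (\<pi> s) a * action_value P \<gamma> R ?W s a) + \<tau> * policy_entropy (\<pi> s)"
    by (subst soft_value_Bellman[OF \<gamma>_pos \<gamma>_less_1]) (simp add: action_value_def)
  moreover have "(\<Sum>a\<in>UNIV. pmf (\<pi> s) a * action_value P \<gamma> R ?V s a) -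
      (\<Sum>a\<in>UNIV. pmf (\<pi> s) a * action_value P \<gamma> R ?W s a)
     = \<gamma> * (\<Sum>a\<in>UNIV. pmf (\<pi> s) a * (\<Sum>s'\<in>UNIV. pmf (P s a) s' * (?V s' - ?W s')))"
    by (simp add: action_value_def sum_subtractf[symmetric] sum_distrib_left algebra_simps)
  ultimately show ?thesis
    by simp
qed

text \<open>The relative entropy is nonnegative, so the negated gap is at most its own discounted
  average, and the maximum bound applies with \<open>c = 0\<close>.\<close>

lemma soft_value_le_opt_value: "soft_value P \<gamma> \<tau> R \<pi> s \<le> opt_value P \<gamma> \<tau> R s"
proof -
  define D where "D s = opt_value P \<gamma> \<tau> R s - soft_value P \<gamma> \<tau> R \<pi> s" for s
  have "- D s \<le> 0 / (1 - \<gamma>)"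
  proof (rule discounted_max_bound[OF \<gamma>_less_1])
    fix B s assume B: "\<And>s. - D s \<le> B"
    have "(\<Sum>s'\<in>UNIV. pmf (P s a) s' * (- D s')) \<le> (\<Sum>s'\<in>UNIV. pmf (P s a) s' * B)" for a
      by (intro sum_mono mult_left_mono B) simp
    then have "(\<Sum>s'\<in>UNIV. pmf (P s a) s' * (- D s')) \<le> B" for a
      by (simp add: sum_pmf_eq_1 flip: sum_distrib_right)
    then have "(\<Sum>a\<in>UNIV. pmf (\<pi> s) a * (\<Sum>s'\<in>UNIV. pmf (P s a) s' * (- D s'))) \<le> (\<Sum>a\<in>UNIV. pmf (\<pi> s) a * B)"
      by (intro sum_mono mult_left_mono) simp_all
    also have "\<dots> = B"
      by (simp add: sum_pmf_eq_1 flip: sum_distrib_right)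
    finally have "- B \<le> (\<Sum>a\<in>UNIV. pmf (\<pi> s) a * (\<Sum>s'\<in>UNIV. pmf (P s a) s' * D s'))"
      by (simp add: sum_negf)
    then have "- (\<gamma> * B) \<le> \<gamma> * (\<Sum>a\<in>UNIV. pmf (\<pi> s) a * (\<Sum>s'\<in>UNIV. pmf (P s a) s' * D s'))"
      using mult_left_mono[of "- B" _ \<gamma>] \<gamma>_pos by simp
    moreover have "0 \<le> \<tau> * (\<Sum>a\<in>UNIV. pmf (\<pi> s) a * (ln (pmf (\<pi> s) a) - ln (pmf (opt_policy R s) a)))"
      using \<tau>_pos relative_entropy_nonneg(1)[OF opt_policy_pos] by simp
    ultimately show "- D s \<le> 0 + \<gamma> * B"
      using opt_value_minus_soft_value[of R s \<pi>] by (simp add: D_def)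
  qed
  then show ?thesis
    by (simp add: D_def)
qed

text \<open>The relative entropy vanishes, so the gap is its own discounted average and must be
  zero.\<close>

lemma soft_value_opt_policy: "soft_value P \<gamma> \<tau> R (opt_policy R) s = opt_value P \<gamma> \<tau> R s"
proof -
  define D where "D s = opt_value P \<gamma> \<tau> R s - soft_value P \<gamma> \<tau> R (opt_policy R) s" for s
  have "\<bar>D s\<bar> \<le> 0 / (1 - \<gamma>)"
  proof (rule discounted_max_bound[OF \<gamma>_less_1])
    fix B s assume "\<And>s. \<bar>D s\<bar> \<le> B"
    then have "\<bar>\<Sum>a\<in>UNIV. pmf (opt_policy R s) a * (\<Sum>s'\<in>UNIV. pmf (P s a) s' * D s')\<bar> \<le> B"
      by (intro abs_pmf_average_le)
    then have "\<gamma> * \<bar>\<Sum>a\<in>UNIV. pmf (opt_policy R s) a * (\<Sum>s'\<in>UNIV. pmf (P s a) s' * D s')\<bar> \<le> \<gamma> * B"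
      using \<gamma>_pos by (intro mult_left_mono) auto
    then show "\<bar>D s\<bar> \<le> 0 + \<gamma> * B"
      using opt_value_minus_soft_value[of R s "opt_policy R"] \<gamma>_pos by (simp add: D_def abs_mult)
  qed
  then show ?thesis
    by (simp add: D_def)
qed

text \<open>A maximiser attains the optimal value in every state because \<open>\<rho>\<close> is
  positive. The identity for the gap then forces zero relative entropy in every state, which gives
  uniqueness and makes \<open>THE\<close> well defined.\<close>

lemma optimal_policy_eq:
  assumes \<rho>: "\<And>s. 0 < pmf \<rho> s"
  shows "optimal_policy P \<gamma> \<tau> \<rho> R = opt_policy R"
  unfolding optimal_policy_def
proof (rule the_equality)
  let ?J = "\<lambda>\<pi>. \<Sum>s\<in>UNIV. pmf \<rho> s * soft_value P \<gamma> \<tau> R \<pi> s"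
  have le: "?J \<pi> \<le> (\<Sum>s\<in>UNIV. pmf \<rho> s * opt_value P \<gamma> \<tau> R s)" for \<pi>
    by (intro sum_mono mult_left_mono soft_value_le_opt_value) simp
  have opt: "?J (opt_policy R) = (\<Sum>s\<in>UNIV. pmf \<rho> s * opt_value P \<gamma> \<tau> R s)"
    by (simp add: soft_value_opt_policy)
  show "is_arg_max ?J (\<lambda>_. True) (opt_policy R)"
    using le opt by (simp add: is_arg_max_def not_less)
  fix \<pi> assume "is_arg_max ?J (\<lambda>_. True) \<pi>"
  then have "?J (opt_policy R) \<le> ?J \<pi>"
    by (simp add: is_arg_max_def not_less)
  then have "(\<Sum>s\<in>UNIV. pmf \<rho> s * (opt_value P \<gamma> \<tau> R s - soft_value P \<gamma> \<tau> R \<pi> s)) = 0"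
    using le[of \<pi>] opt by (simp add: right_diff_distrib sum_subtractf)
  then have "pmf \<rho> s * (opt_value P \<gamma> \<tau> R s - soft_value P \<gamma> \<tau> R \<pi> s) = 0" for s
    by (subst (asm) sum_nonneg_eq_0_iff) (simp_all add: soft_value_le_opt_value)
  then have eq: "opt_value P \<gamma> \<tau> R s - soft_value P \<gamma> \<tau> R \<pi> s = 0" for s
    using \<rho>[of s] by (metis less_irrefl mult_eq_0_iff)
  have "(\<Sum>a\<in>UNIV. pmf (\<pi> s) a * (ln (pmf (\<pi> s) a) - ln (pmf (opt_policy R s) a))) = 0" for s
    using opt_value_minus_soft_value[of R s \<pi>] \<tau>_pos unfolding eq by simp
  then show "\<pi> = opt_policy R"
    by (intro ext relative_entropy_nonneg(2)[OF opt_policy_pos])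
qed

end

section \<open>Expectations under exponentially parameterised weights\<close>


lemma GDERIV_imp_Lipschitz:
  fixes f :: "'v::real_inner \<Rightarrow> real"
  assumes "\<And>x. GDERIV f x :> f' x" and "\<And>x. norm (f' x) \<le> B"
  shows "\<bar>f x - f y\<bar> \<le> B * norm (x - y)"
proof -
  have "norm (f x - f y) \<le> B * norm (x - y)"
  proof (rule differentiable_bound[of UNIV])
    fix x
    show "(f has_derivative (\<lambda>h. inner h (f' x))) (at x within UNIV)"
      using assms(1)[of x] by (simp add: gderiv_def)
    show "onorm (\<lambda>h. inner h (f' x)) \<le> B"
    proof (rule onorm_bound)
      show "0 \<le> B"
        using order_trans[OF norm_ge_zero assms(2)] .
      show "norm (inner h (f' x)) \<le> B * norm h" for h
        using Cauchy_Schwarz_ineq2[of h "f' x"] mult_right_mono[OF assms(2)[of x], of "norm h"]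
        by (simp add: mult.commute)
    qed
  qed auto
  then show ?thesis by simp
qed

text \<open>Differentiating in the direction of \<open>D\<close> itself recovers
  \<open>norm D\<close> as a rate of change.\<close>

lemma norm_GDERIV_le:
  fixes f :: "'v::euclidean_space \<Rightarrow> real"
  assumes D: "GDERIV f x :> D" and lip: "\<And>y. \<bar>f y - f x\<bar> \<le> B * norm (y - x)"
  shows "norm D \<le> B"
proof (rule field_le_epsilon)
  fix e :: real assume "0 < e"
  then obtain d where d: "0 < d" "\<And>y. norm (y - x) < d \<Longrightarrow> norm (f y - f x - inner (y - x) D) \<le> e * norm (y - x)"
    using D unfolding gderiv_def has_derivative_at_alt by blast
  show "norm D \<le> B + e"
  proof (cases "D = 0")
    case True
    \<comment> \<open>Only \<open>0 \<le> B + e\<close> remains; the Lipschitz bound along a unit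
      vector gives \<open>0 \<le> B\<close>.\<close>
    obtain b :: 'v where "b \<in> Basis"
      using nonempty_Basis by blast
    then show ?thesis
      using True lip[of "x + b"] \<open>0 < e\<close> by simp
  next
    case False
    \<comment> \<open>A step of length \<open>d / 2\<close> along \<open>D\<close> stays inside the
      ball of radius \<open>d\<close> and has linear part \<open>d / 2 * norm D\<close>.\<close>
    define y where "y = x + (d / 2 / norm D) *\<^sub>R D"
    have y: "norm (y - x) = d / 2" "inner (y - x) D = d / 2 * norm D"
      using False d(1) by (simp_all add: y_def dot_square_norm power2_eq_square)
    have "d / 2 * norm D \<le> d / 2 * (B + e)"
    proof -
      have "inner (y - x) D \<le> \<bar>f y - f x\<bar> + norm (f y - f x - inner (y - x) D)"
        by simp
      also have "\<dots> \<le> B * norm (y - x) + e * norm (y - x)"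
        by (intro add_mono lip d(2)) (use y d(1) in simp)
      finally show ?thesis
        unfolding y by (simp add: algebra_simps)
    qed
    then show ?thesis
      using d(1) by simp
  qed
qed

lemma GDERIV_sum:
  assumes "\<And>i. i \<in> A \<Longrightarrow> GDERIV (f i) x :> f' i"
  shows "GDERIV (\<lambda>x. \<Sum>i\<in>A. f i x) x :> (\<Sum>i\<in>A. f' i)"
  unfolding gderiv_def inner_sum_right
  by (rule has_derivative_sum) (use assms in \<open>simp add: gderiv_def\<close>)

text \<open>An exponential parameterisation with score \<open>g\<close>. It is instantiated with the
  actions in one state, where \<open>c\<close> is 1, and with trajectory tuples, where
  \<open>c\<close> collects the environment probabilities.\<close>

locale gibbs_weights =
  fixes A :: "'d set" and c :: "'d \<Rightarrow> real" and \<Theta> :: "'d \<Rightarrow> 'v::real_inner \<Rightarrow> real"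
    and g :: "'d \<Rightarrow> 'v \<Rightarrow> 'v" and G :: real
  assumes finite_A: "finite A"
    and c_nonneg: "\<And>d. d \<in> A \<Longrightarrow> 0 \<le> c d"
    and sum_weights: "\<And>x. (\<Sum>d\<in>A. c d * exp (\<Theta> d x)) = 1"
    and GDERIV_\<Theta>: "\<And>d x. d \<in> A \<Longrightarrow> GDERIV (\<Theta> d) x :> g d x"
    and norm_g_le: "\<And>d x. d \<in> A \<Longrightarrow> norm (g d x) \<le> G"
begin

abbreviation weight :: "'d \<Rightarrow> 'v \<Rightarrow> real" where
  "weight d x \<equiv> c d * exp (\<Theta> d x)"

lemma weight_nonneg: "d \<in> A \<Longrightarrow> 0 \<le> weight d x"
  by (simp add: c_nonneg)

lemma GDERIV_weight:
  assumes "d \<in> A"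
  shows "GDERIV (weight d) x :> weight d x *\<^sub>R g d x"
proof -
  have "DERIV (\<lambda>t. c d * exp t) (\<Theta> d x) :> weight d x"
    by (auto intro!: derivative_eq_intros)
  from GDERIV_DERIV_compose[OF GDERIV_\<Theta>[OF assms] this] show ?thesis .
qed

lemma norm_weighted_sum_le:
  fixes f :: "'d \<Rightarrow> 'w::real_normed_vector"
  assumes "\<And>d. d \<in> A \<Longrightarrow> norm (f d) \<le> B"
  shows "norm (\<Sum>d\<in>A. weight d x *\<^sub>R f d) \<le> B"
proof -
  have "norm (\<Sum>d\<in>A. weight d x *\<^sub>R f d) \<le> (\<Sum>d\<in>A. weight d x * B)"
  proof (rule sum_norm_le)
    fix d assume "d \<in> A"
    then show "norm (weight d x *\<^sub>R f d) \<le> weight d x * B"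
      using mult_left_mono[OF assms weight_nonneg] by (simp add: c_nonneg)
  qed
  also have "\<dots> = B"
    using sum_weights[of x] by (simp flip: sum_distrib_right)
  finally show ?thesis .
qed

text \<open>The \<open>\<ell>\<^sup>1\<close> distance is \<open>\<Sum> \<sigma>\<^sub>d (w\<^sub>d x\<^sub>1 - w\<^sub>d x\<^sub>2)\<close> for the signs \<open>\<sigma>\<close> of the
  differences, and \<open>\<Sum> \<sigma>\<^sub>d w\<^sub>d\<close> has gradient \<open>\<Sum> w\<^sub>d \<sigma>\<^sub>d g\<^sub>d\<close> for fixed \<open>\<sigma>\<close>.\<close>

lemma weight_diff_l1:
  "(\<Sum>d\<in>A. \<bar>weight d x1 - weight d x2\<bar>) \<le> G * norm (x1 - x2)"
proof -
  define \<sigma> where "\<sigma> d = sgn (weight d x1 - weight d x2)" for d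
  let ?F = "\<lambda>x. \<Sum>d\<in>A. weight d x * \<sigma> d"
  have "\<bar>?F x1 - ?F x2\<bar> \<le> G * norm (x1 - x2)"
  proof (rule GDERIV_imp_Lipschitz)
    fix x
    show "GDERIV ?F x :> (\<Sum>d\<in>A. weight d x *\<^sub>R (\<sigma> d *\<^sub>R g d x))"
    proof (rule GDERIV_sum)
      fix d assume "d \<in> A"
      from GDERIV_mult[OF GDERIV_weight[OF this] GDERIV_const]
      show "GDERIV (\<lambda>x. weight d x * \<sigma> d) x :> weight d x *\<^sub>R (\<sigma> d *\<^sub>R g d x)"
        by (rule GDERIV_subst) (simp add: mult_ac)
    qed
    show "norm (\<Sum>d\<in>A. weight d x *\<^sub>R (\<sigma> d *\<^sub>R g d x)) \<le> G"
    proof (rule norm_weighted_sum_le)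
      fix d assume d: "d \<in> A"
      have "\<bar>\<sigma> d\<bar> * norm (g d x) \<le> 1 * norm (g d x)"
        by (rule mult_right_mono) (auto simp: \<sigma>_def sgn_if)
      then show "norm (\<sigma> d *\<^sub>R g d x) \<le> G"
        using norm_g_le[OF d, of x] by simp
    qed
  qed
  moreover have "?F x1 - ?F x2 = (\<Sum>d\<in>A. \<bar>weight d x1 - weight d x2\<bar>)"
    unfolding sum_subtractf[symmetric]
    by (intro sum.cong refl) (simp add: \<sigma>_def sgn_if algebra_simps)
  ultimately show ?thesis
    by simp
qed

text \<open>The change of the integrand is averaged under the weights at \<open>x1\<close> and costs
  \<open>M\<close>; the change of the weights costs their l1 distance times
  \<open>B\<close>.\<close>

lemma weighted_sum_diff:
  fixes f :: "'v \<Rightarrow> 'd \<Rightarrow> 'w::real_normed_vector"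
  assumes "\<And>d. d \<in> A \<Longrightarrow> norm (f x2 d) \<le> B"
    and "\<And>d. d \<in> A \<Longrightarrow> norm (f x1 d - f x2 d) \<le> M"
  shows "norm ((\<Sum>d\<in>A. weight d x1 *\<^sub>R f x1 d) - (\<Sum>d\<in>A. weight d x2 *\<^sub>R f x2 d))
     \<le> M + G * B * norm (x1 - x2)"
proof -
  have "A \<noteq> {}"
    using sum_weights by fastforce
  then have "0 \<le> B"
    using order_trans[OF norm_ge_zero assms(1)] by blast
  have "(\<Sum>d\<in>A. weight d x1 *\<^sub>R f x1 d) - (\<Sum>d\<in>A. weight d x2 *\<^sub>R f x2 d) =
     (\<Sum>d\<in>A. weight d x1 *\<^sub>R (f x1 d - f x2 d)) + (\<Sum>d\<in>A. (weight d x1 - weight d x2) *\<^sub>R f x2 d)"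
    by (simp add: scaleR_diff_right scaleR_diff_left sum_subtractf)
  moreover have "norm (\<Sum>d\<in>A. weight d x1 *\<^sub>R (f x1 d - f x2 d)) \<le> M"
    by (rule norm_weighted_sum_le) (rule assms)
  moreover have "norm (\<Sum>d\<in>A. (weight d x1 - weight d x2) *\<^sub>R f x2 d) \<le> (\<Sum>d\<in>A. \<bar>weight d x1 - weight d x2\<bar> * B)"
    by (rule sum_norm_le) (simp add: assms mult_left_mono)
  moreover have "(\<Sum>d\<in>A. \<bar>weight d x1 - weight d x2\<bar> * B) \<le> G * norm (x1 - x2) * B"
    using mult_right_mono[OF weight_diff_l1 \<open>0 \<le> B\<close>] by (simp flip: sum_distrib_right)
  ultimately show ?thesis
    using norm_triangle_ineq[of "\<Sum>d\<in>A. weight d x1 *\<^sub>R (f x1 d - f x2 d)"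
        "\<Sum>d\<in>A. (weight d x1 - weight d x2) *\<^sub>R f x2 d"]
    by (simp add: algebra_simps)
qed

text \<open>Score-function formula: the gradient is the mean of \<open>f' + f g\<close>. This
  integrand is bounded by \<open>L + C * G\<close> and, by the product rule, Lipschitz with constant
  \<open>L' + (C * G' + L * G)\<close>; \<open>weighted_sum_diff\<close> combines the two.\<close>

lemma expectation_smooth:
  fixes f :: "'d \<Rightarrow> 'v \<Rightarrow> real" and f' :: "'d \<Rightarrow> 'v \<Rightarrow> 'v"
  assumes f: "\<And>d x. d \<in> A \<Longrightarrow> GDERIV (f d) x :> f' d x"
    and f_le: "\<And>d x. d \<in> A \<Longrightarrow> \<bar>f d x\<bar> \<le> C"
    and f_lip: "\<And>d x1 x2. d \<in> A \<Longrightarrow> \<bar>f d x1 - f d x2\<bar> \<le> L * norm (x1 - x2)"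
    and f'_le: "\<And>d x. d \<in> A \<Longrightarrow> norm (f' d x) \<le> L"
    and f'_lip: "\<And>d x1 x2. d \<in> A \<Longrightarrow> norm (f' d x1 - f' d x2) \<le> L' * norm (x1 - x2)"
    and g_lip: "\<And>d x1 x2. d \<in> A \<Longrightarrow> norm (g d x1 - g d x2) \<le> G' * norm (x1 - x2)"
  defines "h \<equiv> \<lambda>x. \<Sum>d\<in>A. weight d x *\<^sub>R (f' d x + f d x *\<^sub>R g d x)"
  shows "GDERIV (\<lambda>x. \<Sum>d\<in>A. weight d x * f d x) x :> h x"
    and "norm (h x1 - h x2) \<le> (L' + (C * G' + L * G) + G * (L + C * G)) * norm (x1 - x2)"
proof -
  show "GDERIV (\<lambda>x. \<Sum>d\<in>A. weight d x * f d x) x :> h x"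
    unfolding h_def
  proof (rule GDERIV_sum)
    fix d assume d: "d \<in> A"
    from GDERIV_mult[OF GDERIV_weight[OF d] f[OF d]]
    show "GDERIV (\<lambda>x. weight d x * f d x) x :> weight d x *\<^sub>R (f' d x + f d x *\<^sub>R g d x)"
      by (rule GDERIV_subst) (simp add: scaleR_add_right mult_ac)
  qed
  have "norm (h x1 - h x2) \<le> (L' + (C * G' + L * G)) * norm (x1 - x2) + G * (L + C * G) * norm (x1 - x2)"
    unfolding h_def
  proof (rule weighted_sum_diff)
    fix d assume d: "d \<in> A"
    have C: "0 \<le> C"
      using f_le[OF d, of x1] by linarith
    show "norm (f' d x2 + f d x2 *\<^sub>R g d x2) \<le> L + C * G"
      by (rule norm_triangle_le) (use d f_le f'_le norm_g_le C in \<open>auto intro!: add_mono mult_mono\<close>)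
    \<comment> \<open>The product difference is split so that \<open>C\<close> bounds
      \<open>f\<close> at \<open>x1\<close> and \<open>G\<close> bounds \<open>g\<close> at
      \<open>x2\<close>.\<close>
    have "f' d x1 + f d x1 *\<^sub>R g d x1 - (f' d x2 + f d x2 *\<^sub>R g d x2) =
        (f' d x1 - f' d x2) + (f d x1 *\<^sub>R (g d x1 - g d x2) + (f d x1 - f d x2) *\<^sub>R g d x2)"
      by (simp add: algebra_simps)
    also have "norm \<dots> \<le> L' * norm (x1 - x2) + (C * (G' * norm (x1 - x2)) + (L * norm (x1 - x2)) * G)"
    proof (intro norm_triangle_le add_mono f'_lip d)
      show "norm (f d x1 *\<^sub>R (g d x1 - g d x2)) \<le> C * (G' * norm (x1 - x2))"
        unfolding norm_scaleR real_norm_def by (intro mult_mono f_le g_lip d C) simp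
      show "norm ((f d x1 - f d x2) *\<^sub>R g d x2) \<le> (L * norm (x1 - x2)) * G"
        unfolding norm_scaleR real_norm_def
        by (intro mult_mono f_lip norm_g_le d order_trans[OF abs_ge_zero f_lip[OF d]]) simp
    qed
    finally show "norm (f' d x1 + f d x1 *\<^sub>R g d x1 - (f' d x2 + f d x2 *\<^sub>R g d x2))
        \<le> (L' + (C * G' + L * G)) * norm (x1 - x2)"
      by (simp add: algebra_simps)
  qed
  then show "norm (h x1 - h x2) \<le> (L' + (C * G' + L * G) + G * (L + C * G)) * norm (x1 - x2)"
    by (simp add: algebra_simps)
qed

end

section \<open>Dependence of the optimal policy on the reward parameter\<close>


locale smooth_soft_mdp = soft_mdp P \<gamma> \<tau>
  for P :: "('s::finite, 'a::finite) kernel" and \<gamma> \<tau> :: real +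
  fixes r :: "'v::euclidean_space \<Rightarrow> 's \<Rightarrow> 'a \<Rightarrow> real" and r' :: "'v \<Rightarrow> 's \<Rightarrow> 'a \<Rightarrow> 'v"
    and C L :: real
  assumes GDERIV_r: "\<And>s a x. GDERIV (\<lambda>x. r x s a) x :> r' x s a"
    and norm_r'_le: "\<And>s a x. norm (r' x s a) \<le> C"
    and r'_Lipschitz: "\<And>s a x1 x2. norm (r' x1 s a - r' x2 s a) \<le> L * norm (x1 - x2)"
begin

abbreviation policy :: "'v \<Rightarrow> 's \<Rightarrow> 'a pmf" where
  "policy x \<equiv> opt_policy (r x)"

abbreviation V :: "'v \<Rightarrow> 's \<Rightarrow> real" where
  "V x \<equiv> opt_value P \<gamma> \<tau> (r x)"

abbreviation Q :: "'v \<Rightarrow> 's \<Rightarrow> 'a \<Rightarrow> real" where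
  "Q x \<equiv> action_value P \<gamma> (r x) (V x)"

text \<open>Candidate gradient of \<open>V\<close>: differentiating the soft Bellman equation gives
  this linear one, as the gradient of log-sum-exp is the softmax. \<open>GDERIV_V\<close> confirms
  it.\<close>

definition V' :: "'v \<Rightarrow> 's \<Rightarrow> 'v" where
  "V' x = (SOME U. \<forall>s. U s = (\<Sum>a\<in>UNIV. pmf (policy x s) a *\<^sub>R action_value P \<gamma> (r' x) U s a))"

abbreviation Q' :: "'v \<Rightarrow> 's \<Rightarrow> 'a \<Rightarrow> 'v" where
  "Q' x \<equiv> action_value P \<gamma> (r' x) (V' x)"

lemma C_nonneg: "0 \<le> C"
  using order_trans[OF norm_ge_zero norm_r'_le] .

lemma r_Lipschitz: "\<bar>r x s a - r y s a\<bar> \<le> C * norm (x - y)"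
  by (rule GDERIV_imp_Lipschitz[where f="\<lambda>x. r x s a" and f'="\<lambda>x. r' x s a"])
    (rule GDERIV_r norm_r'_le)+

lemma discounted_sum: "b + \<gamma> * (b / (1 - \<gamma>)) = b / (1 - \<gamma>)"
  using \<gamma>_less_1 by (simp add: field_simps)

text \<open>Rewards move by at most \<open>C * norm (x - y)\<close>, log-sum-exp is nonexpansive,
  and discounting accumulates the effect.\<close>

lemma V_Lipschitz: "\<bar>V x s - V y s\<bar> \<le> C * norm (x - y) / (1 - \<gamma>)"
proof (rule discounted_max_bound[OF \<gamma>_less_1])
  fix B s assume B: "\<And>s. \<bar>V x s - V y s\<bar> \<le> B"
  have "norm (Q x s a - Q y s a) \<le> C * norm (x - y) + \<gamma> * B" for a
    unfolding action_value_diff using \<gamma>_pos B r_Lipschitz by (intro norm_action_value_le) auto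
  then show "\<bar>V x s - V y s\<bar> \<le> C * norm (x - y) + \<gamma> * B"
    using log_sum_exp_nonexpansive[OF \<tau>_pos, of "Q x s" "Q y s"]
    by (subst (1 2) opt_value_eq) simp
qed

lemma Q_Lipschitz: "\<bar>Q x s a - Q y s a\<bar> \<le> C * norm (x - y) / (1 - \<gamma>)"
proof -
  have "norm (Q x s a - Q y s a) \<le> C * norm (x - y) + \<gamma> * (C * norm (x - y) / (1 - \<gamma>))"
    unfolding action_value_diff using \<gamma>_pos V_Lipschitz r_Lipschitz by (intro norm_action_value_le) auto
  then show ?thesis
    by (simp only: discounted_sum real_norm_def)
qed

lemma V'_eq: "V' x s = (\<Sum>a\<in>UNIV. pmf (policy x s) a *\<^sub>R Q' x s a)"
proof -
  have "\<exists>U. (\<lambda>s. \<Sum>a\<in>UNIV. pmf (policy x s) a *\<^sub>R action_value P \<gamma> (r' x) U s a) = U"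
  proof (rule contraction_fixed_point)
    fix U W :: "'s \<Rightarrow> 'v" and B s
    assume "\<And>s. norm (U s - W s) \<le> B"
    then have "norm (action_value P \<gamma> (r' x) U s a - action_value P \<gamma> (r' x) W s a) \<le> 0 + \<gamma> * B" for a
      unfolding action_value_diff using \<gamma>_pos by (intro norm_action_value_le) auto
    then show "norm ((\<Sum>a\<in>UNIV. pmf (policy x s) a *\<^sub>R action_value P \<gamma> (r' x) U s a) -
        (\<Sum>a\<in>UNIV. pmf (policy x s) a *\<^sub>R action_value P \<gamma> (r' x) W s a)) \<le> \<gamma> * B"
      unfolding sum_subtractf[symmetric] scaleR_diff_right[symmetric]
      by (intro norm_pmf_average_le) simp
  qed (use \<gamma>_pos \<gamma>_less_1 in auto)
  then obtain U where U: "(\<lambda>s. \<Sum>a\<in>UNIV. pmf (policy x s) a *\<^sub>R action_value P \<gamma> (r' x) U s a) = U" ..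
  have "\<exists>U. \<forall>s. U s = (\<Sum>a\<in>UNIV. pmf (policy x s) a *\<^sub>R action_value P \<gamma> (r' x) U s a)"
    by (intro exI[of _ U] allI fun_cong[OF U, symmetric])
  then have "\<forall>s. V' x s = (\<Sum>a\<in>UNIV. pmf (policy x s) a *\<^sub>R Q' x s a)"
    unfolding V'_def by (rule someI_ex)
  from this[rule_format] show ?thesis .
qed

lemma norm_V'_le: "norm (V' x s) \<le> C / (1 - \<gamma>)"
proof (rule discounted_max_bound[OF \<gamma>_less_1])
  fix B s assume B: "\<And>s. norm (V' x s) \<le> B"
  show "norm (V' x s) \<le> C + \<gamma> * B"
    by (subst V'_eq, intro norm_pmf_average_le norm_action_value_le B norm_r'_le)
      (use \<gamma>_pos in simp)
qed

lemma norm_Q'_le: "norm (Q' x s a) \<le> C / (1 - \<gamma>)"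
proof -
  have "norm (Q' x s a) \<le> C + \<gamma> * (C / (1 - \<gamma>))"
    using \<gamma>_pos by (intro norm_action_value_le norm_r'_le norm_V'_le) simp
  then show ?thesis
    by (simp only: discounted_sum)
qed

text \<open>Continuity of the policy comes from the Lipschitz bounds on \<open>V\<close> and
  \<open>Q\<close>, before differentiability of either is known.\<close>

lemma tendsto_policy: "((\<lambda>y. \<Sum>a\<in>UNIV. \<bar>pmf (policy y s) a - pmf (policy x s) a\<bar>) \<longlongrightarrow> 0) (at x)"
proof -
  have lim: "((\<lambda>y. f y) \<longlongrightarrow> f x) (at x)" if "\<And>y. \<bar>f y - f x\<bar> \<le> C * norm (y - x) / (1 - \<gamma>)" for f :: "'v \<Rightarrow> real"
  proof (rule LIM_zero_cancel, rule Lim_null_comparison)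
    show "\<forall>\<^sub>F y in at x. norm (f y - f x) \<le> C * norm (y - x) / (1 - \<gamma>)"
      using that by (intro always_eventually) simp
    show "((\<lambda>y. C * norm (y - x) / (1 - \<gamma>)) \<longlongrightarrow> 0) (at x)"
      using \<gamma>_less_1 by (auto intro!: tendsto_eq_intros)
  qed
  have "((\<lambda>y. pmf (policy y s) a) \<longlongrightarrow> pmf (policy x s) a) (at x)" for a
    unfolding pmf_opt_policy using \<tau>_pos
    by (intro tendsto_intros lim V_Lipschitz Q_Lipschitz) simp
  from tendsto_rabs_zero[OF LIM_zero[OF this]] show ?thesis
    by (intro tendsto_null_sum)
qed

text \<open>Convexity of the log-sum-exp function bounds \<open>V y - V x\<close> from below by the average of
  \<open>Q y - Q x\<close> under \<^term>\<open>policy x\<close> and from above by the average under \<^term>\<open>policy y\<close>. These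
  differ by \<open>o(\<parallel>y - x\<parallel>)\<close>, so the linearisation error of \<open>V\<close> satisfies a discounted
  inequality.\<close>

lemma GDERIV_V: "GDERIV (\<lambda>x. V x s) x :> V' x s"
  unfolding gderiv_def has_derivative_within_alt2
proof (intro conjI allI impI)
  show "bounded_linear (\<lambda>h. inner h (V' x s))"
    by (rule bounded_linear_inner_left)
  fix e :: real assume "0 < e"
  define K where "K = C / (1 - \<gamma>)"
  have K: "0 \<le> K"
    using C_nonneg \<gamma>_less_1 by (simp add: K_def)
  \<comment> \<open>\<open>K\<close> is the Lipschitz constant of \<open>Q\<close>. The tolerance
    \<open>e0\<close> enters once for the rewards and once, times \<open>K\<close>, for the policy;
    discounting divides by \<open>1 - \<gamma>\<close>, so the total is \<open>e\<close>.\<close>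
  define e0 where "e0 = e * (1 - \<gamma>) / (1 + K)"
  have e0: "0 < e0" "e0 * (1 + K) / (1 - \<gamma>) = e"
    using \<open>0 < e\<close> K \<gamma>_less_1 by (simp_all add: e0_def)
  have "\<forall>\<^sub>F y in at x. \<bar>r y s a - r x s a - inner (y - x) (r' x s a)\<bar> \<le> e0 * norm (y - x)" for s a
    using GDERIV_r[where s=s and a=a and x=x] e0(1)
    unfolding gderiv_def has_derivative_within_alt2 by auto
  then have 1: "\<forall>\<^sub>F y in at x. \<forall>s a. \<bar>r y s a - r x s a - inner (y - x) (r' x s a)\<bar> \<le> e0 * norm (y - x)"
    by (intro eventually_all_finite)
  have "\<forall>\<^sub>F y in at x. (\<Sum>a\<in>UNIV. \<bar>pmf (policy y s) a - pmf (policy x s) a\<bar>) < e0" for s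
    using tendsto_policy e0(1) by (rule order_tendstoD)
  then have 2: "\<forall>\<^sub>F y in at x. \<forall>s. (\<Sum>a\<in>UNIV. \<bar>pmf (policy y s) a - pmf (policy x s) a\<bar>) < e0"
    by (rule eventually_all_finite)
  show "\<forall>\<^sub>F y in at x. norm (V y s - V x s - inner (y - x) (V' x s)) \<le> e * norm (y - x)"
    using 1 2
  proof eventually_elim
    case (elim y)
    define E where "E s = V y s - V x s - inner (y - x) (V' x s)" for s
    have "\<bar>E s\<bar> \<le> e0 * (1 + K) * norm (y - x) / (1 - \<gamma>)"
    proof (rule discounted_max_bound[OF \<gamma>_less_1])
      fix B s assume B: "\<And>s. \<bar>E s\<bar> \<le> B"
      define S where "S = (\<Sum>a\<in>UNIV. pmf (policy x s) a * (Q y s a - Q x s a))"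
      define S' where "S' = (\<Sum>a\<in>UNIV. pmf (policy y s) a * (Q y s a - Q x s a))"
      have "S \<le> V y s - V x s"
        using log_sum_exp_diff_ge[OF \<tau>_pos, of "Q x s" "Q y s"]
        by (simp add: S_def opt_policy_def flip: opt_value_eq)
      moreover have "- S' \<le> V x s - V y s"
        using log_sum_exp_diff_ge[OF \<tau>_pos, of "Q y s" "Q x s"]
        by (simp add: S'_def opt_policy_def right_diff_distrib sum_subtractf flip: opt_value_eq)
      moreover have "\<bar>S' - S\<bar> \<le> e0 * (K * norm (y - x))"
      proof -
        have "\<bar>S' - S\<bar> \<le> (\<Sum>a\<in>UNIV. \<bar>(pmf (policy y s) a - pmf (policy x s) a) * (Q y s a - Q x s a)\<bar>)"
          unfolding S_def S'_def sum_subtractf[symmetric] left_diff_distrib[symmetric] by (rule sum_abs)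
        also have "\<dots> \<le> (\<Sum>a\<in>UNIV. \<bar>pmf (policy y s) a - pmf (policy x s) a\<bar> * (K * norm (y - x)))"
          unfolding abs_mult using Q_Lipschitz[of y s _ x]
          by (intro sum_mono mult_left_mono) (auto simp: K_def)
        also have "\<dots> \<le> e0 * (K * norm (y - x))"
          using elim(2)[rule_format, of s] K
          by (simp only: sum_distrib_right[symmetric]) (intro mult_right_mono, auto)
        finally show ?thesis .
      qed
      moreover have "\<bar>S - inner (y - x) (V' x s)\<bar> \<le> e0 * norm (y - x) + \<gamma> * B"
      proof -
        \<comment> \<open>The linearisation error of \<open>Q\<close> is the action value of the
          reward's linearisation error with continuation \<open>E\<close>, which is the source of
          the term \<open>\<gamma> * B\<close>.\<close>
        have "(Q y s a - Q x s a) - inner (y - x) (Q' x s a) =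
            action_value P \<gamma> (\<lambda>s a. r y s a - r x s a - inner (y - x) (r' x s a)) E s a" for a
          by (simp add: action_value_def E_def inner_add_right inner_sum_right sum_subtractf right_diff_distrib)
        then have "S - inner (y - x) (V' x s) = (\<Sum>a\<in>UNIV. pmf (policy x s) a *
            action_value P \<gamma> (\<lambda>s a. r y s a - r x s a - inner (y - x) (r' x s a)) E s a)"
          by (subst V'_eq) (simp add: S_def inner_sum_right sum_subtractf[symmetric] right_diff_distrib[symmetric])
        also have "\<bar>\<dots>\<bar> \<le> e0 * norm (y - x) + \<gamma> * B"
          unfolding real_norm_def[symmetric]
          by (intro abs_pmf_average_le[unfolded real_norm_def[symmetric]] norm_action_value_le)
            (use \<gamma>_pos B elim(1) in auto)
        finally show ?thesis .
      qed
      ultimately show "\<bar>E s\<bar> \<le> e0 * (1 + K) * norm (y - x) + \<gamma> * B"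
        unfolding E_def by (simp add: algebra_simps abs_le_iff)
    qed
    also have "e0 * (1 + K) * norm (y - x) / (1 - \<gamma>) = e * norm (y - x)"
      unfolding e0(2)[symmetric] by simp
    finally show ?case
      by (simp add: E_def)
  qed
qed

lemma GDERIV_Q: "GDERIV (\<lambda>x. Q x s a) x :> Q' x s a"
proof -
  have "GDERIV (\<lambda>x. r x s a + \<gamma> * (\<Sum>s'\<in>UNIV. pmf (P s a) s' * V x s')) x :>
      r' x s a + (\<gamma> *\<^sub>R (\<Sum>s'\<in>UNIV. pmf (P s a) s' *\<^sub>R V' x s' + V x s' *\<^sub>R 0)
        + (\<Sum>s'\<in>UNIV. pmf (P s a) s' * V x s') *\<^sub>R 0)"
    by (intro GDERIV_add GDERIV_r GDERIV_mult GDERIV_const GDERIV_sum GDERIV_V)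
  then show ?thesis
    by (simp add: action_value_def)
qed

section \<open>Score of the optimal policy: bound and Lipschitz constant\<close>

definition log_policy :: "'s \<times> 'a \<Rightarrow> 'v \<Rightarrow> real" where
  "log_policy z x = (Q x (fst z) (snd z) - V x (fst z)) / \<tau>"

definition score :: "'s \<times> 'a \<Rightarrow> 'v \<Rightarrow> 'v" where
  "score z x = inverse \<tau> *\<^sub>R (Q' x (fst z) (snd z) - V' x (fst z))"

text \<open>The bounds on \<open>Q'\<close> and \<open>V'\<close> added and divided by
  \<open>\<tau>\<close>; by \<open>weight_diff_l1\<close> it is also an l1 Lipschitz constant of the
  policy.\<close>

definition score_bound :: real where
  "score_bound = 2 * C / (\<tau> * (1 - \<gamma>))"

text \<open>Lipschitz constant of \<open>V'\<close>: \<open>L\<close> from the rewards and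
  \<open>score_bound\<close> times the bound on \<open>Q'\<close> from the moving policy,
  accumulated over discounted time.\<close>

definition value_smoothness :: real where
  "value_smoothness = (L + score_bound * (C / (1 - \<gamma>))) / (1 - \<gamma>)"

lemma policy_eq_exp: "pmf (policy x s) a = exp (log_policy (s, a) x)"
  by (simp add: pmf_opt_policy log_policy_def)

lemma GDERIV_log_policy: "GDERIV (log_policy z) x :> score z x"
proof -
  have "GDERIV (\<lambda>x. inverse \<tau> * (Q x (fst z) (snd z) - V x (fst z))) x :>
      inverse \<tau> *\<^sub>R (Q' x (fst z) (snd z) - V' x (fst z)) + (Q x (fst z) (snd z) - V x (fst z)) *\<^sub>R 0"
    by (intro GDERIV_mult GDERIV_const GDERIV_diff GDERIV_Q GDERIV_V)
  then show ?thesis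
    by (simp add: log_policy_def[abs_def] score_def divide_inverse_commute)
qed

lemma norm_score_le: "norm (score z x) \<le> score_bound"
proof -
  have "norm (Q' x (fst z) (snd z) - V' x (fst z)) \<le> C / (1 - \<gamma>) + C / (1 - \<gamma>)"
    by (intro norm_triangle_le_diff add_mono norm_Q'_le norm_V'_le)
  from mult_left_mono[OF this, of "inverse \<tau>"]
  have "norm (score z x) \<le> inverse \<tau> * (C / (1 - \<gamma>) + C / (1 - \<gamma>))"
    using \<tau>_pos unfolding score_def norm_scaleR by simp
  then show ?thesis
    by (simp add: score_bound_def divide_inverse mult_ac)
qed

lemma score_bound_nonneg: "0 \<le> score_bound"
  using order_trans[OF norm_ge_zero norm_score_le] .

lemma gibbs_weights_policy:
  "gibbs_weights UNIV (\<lambda>_. 1) (\<lambda>a. log_policy (s, a)) (\<lambda>a. score (s, a)) score_bound"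
proof
  show "(\<Sum>a\<in>UNIV. 1 * exp (log_policy (s, a) x)) = 1" for x
    by (simp add: sum_pmf_eq_1 flip: policy_eq_exp)
qed (auto intro: GDERIV_log_policy norm_score_le)

text \<open>Both the averaging policy and \<open>Q'\<close> move with the parameter;
  \<open>weighted_sum_diff\<close> separates the effects, and the dependence of \<open>Q'\<close> on
  \<open>V'\<close> gives the discounted term.\<close>

lemma V'_Lipschitz: "norm (V' x s - V' y s) \<le> value_smoothness * norm (x - y)"
proof -
  have "norm (V' x s - V' y s)
      \<le> (L * norm (x - y) + score_bound * (C / (1 - \<gamma>)) * norm (x - y)) / (1 - \<gamma>)"
  proof (rule discounted_max_bound[OF \<gamma>_less_1])
    fix B s assume B: "\<And>s. norm (V' x s - V' y s) \<le> B"
    interpret gibbs_weights UNIV "\<lambda>_. 1" "\<lambda>a. log_policy (s, a)" "\<lambda>a. score (s, a)" score_bound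
      by (rule gibbs_weights_policy)
    have "norm ((\<Sum>a\<in>UNIV. weight a x *\<^sub>R Q' x s a) - (\<Sum>a\<in>UNIV. weight a y *\<^sub>R Q' y s a))
        \<le> (L * norm (x - y) + \<gamma> * B) + score_bound * (C / (1 - \<gamma>)) * norm (x - y)"
    proof (rule weighted_sum_diff)
      show "norm (Q' x s a - Q' y s a) \<le> L * norm (x - y) + \<gamma> * B" for a
        unfolding action_value_diff using \<gamma>_pos r'_Lipschitz B by (intro norm_action_value_le) auto
    qed (rule norm_Q'_le)
    then show "norm (V' x s - V' y s)
        \<le> (L * norm (x - y) + score_bound * (C / (1 - \<gamma>)) * norm (x - y)) + \<gamma> * B"
      by (subst (1 2) V'_eq) (simp add: policy_eq_exp)
  qed
  then show ?thesis
    by (simp add: value_smoothness_def algebra_simps)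
qed

lemma Q'_Lipschitz: "norm (Q' x s a - Q' y s a) \<le> value_smoothness * norm (x - y)"
proof -
  define b where "b = score_bound * (C / (1 - \<gamma>))"
  have "0 \<le> b"
    using score_bound_nonneg C_nonneg \<gamma>_less_1 by (simp add: b_def)
  have "norm (Q' x s a - Q' y s a) \<le> L * norm (x - y) + \<gamma> * (value_smoothness * norm (x - y))"
    unfolding action_value_diff using \<gamma>_pos r'_Lipschitz V'_Lipschitz by (intro norm_action_value_le) auto
  also have "\<dots> = (L + \<gamma> * ((L + b) / (1 - \<gamma>))) * norm (x - y)"
    by (simp add: value_smoothness_def b_def algebra_simps)
  \<comment> \<open>Adding the slack \<open>b\<close> makes \<open>discounted_sum\<close>
    applicable, so \<open>Q'\<close> gets the same constant as \<open>V'\<close>.\<close>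
  also have "\<dots> \<le> ((L + b) + \<gamma> * ((L + b) / (1 - \<gamma>))) * norm (x - y)"
    using \<open>0 \<le> b\<close> by (intro mult_right_mono add_right_mono) auto
  also have "\<dots> = value_smoothness * norm (x - y)"
    by (simp only: discounted_sum value_smoothness_def b_def)
  finally show ?thesis .
qed

lemma score_Lipschitz: "norm (score z x - score z y) \<le> 2 * inverse \<tau> * value_smoothness * norm (x - y)"
proof -
  have "score z x - score z y =
      inverse \<tau> *\<^sub>R ((Q' x (fst z) (snd z) - Q' y (fst z) (snd z)) - (V' x (fst z) - V' y (fst z)))"
    by (simp add: score_def algebra_simps)
  also have "norm \<dots> \<le> inverse \<tau> * (value_smoothness * norm (x - y) + value_smoothness * norm (x - y))"
    unfolding norm_scaleR using \<tau>_pos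
    by (intro mult_mono norm_triangle_le_diff add_mono Q'_Lipschitz V'_Lipschitz) auto
  finally show ?thesis
    by (simp add: algebra_simps)
qed

end

section \<open>Trajectory distributions and the hyper-objective\<close>


lemma pmf_replicate_pmf:
  "pmf (replicate_pmf n p) D = (if length D = n then \<Prod>i<n. pmf p (D ! i) else 0)"
proof (induction n arbitrary: D)
  case 0
  then show ?case
    by (auto split: split_indicator)
next
  case (Suc n)
  have eq: "replicate_pmf (Suc n) p = map_pmf (\<lambda>(x, xs). x # xs) (pair_pmf p (replicate_pmf n p))"
    by (simp add: pair_pmf_def map_bind_pmf)
  show ?case
  proof (cases D)
    case Nil
    then show ?thesis
      unfolding eq by (auto intro: pmf_map_outside)
  next
    case (Cons x xs)
    have "inj (\<lambda>(x :: 'a, xs). x # xs)"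
      by (auto simp: inj_def)
    from pmf_map_inj'[OF this, of "pair_pmf p (replicate_pmf n p)" "(x, xs)"]
    show ?thesis
      unfolding eq Cons by (simp add: pmf_pair Suc prod.lessThan_Suc_shift del: prod.lessThan_Suc)
  qed
qed

lemma finite_traj_tuples: "finite (traj_tuples I H :: ('s::finite, 'a::finite) trajectory list set)"
proof -
  have "finite {d :: ('s, 'a) trajectory. length d = H}"
    using finite_lists_length_eq[of "UNIV :: ('s \<times> 'a) set" H] by simp
  from finite_lists_length_eq[OF this, of I] show ?thesis
    by (rule rev_finite_subset) (auto simp: traj_tuples_def)
qed

text \<open>The factors that do not depend on the policy; over a tuple their product is the constant
  \<open>c\<close> of the Gibbs weights.\<close>

definition env_weight :: "('s, 'a) kernel \<Rightarrow> 's pmf \<Rightarrow> nat \<Rightarrow> ('s, 'a) trajectory \<Rightarrow> real" where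
  "env_weight P \<rho> H d =
     pmf \<rho> (fst (d ! 0)) * (\<Prod>h<H - 1. pmf (P (fst (d ! h)) (snd (d ! h))) (fst (d ! (h + 1))))"

lemma traj_prob_eq:
  assumes "1 \<le> H" "length d = H"
  shows "traj_prob P \<rho> H \<pi> d =
    env_weight P \<rho> H d * (\<Prod>h<H. pmf (\<pi> (fst (d ! h))) (snd (d ! h)))"
proof -
  \<comment> \<open>\<open>traj_prob\<close> keeps the last action factor outside its product; with
    \<open>H = Suc n\<close> it completes the product over \<open>h < H\<close>.\<close>
  obtain n where "H = Suc n"
    using assms by (cases H) auto
  then show ?thesis
    using assms by (simp add: traj_prob_def env_weight_def prod.distrib mult_ac)
qed

lemma pmf_replicate_traj_pmf:
  fixes P :: "('s::finite, 'a::finite) kernel"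
  assumes "1 \<le> H" "D \<in> traj_tuples I H"
  shows "pmf (replicate_pmf I (traj_pmf P \<rho> H \<pi>)) D =
    (\<Prod>i<I. env_weight P \<rho> H (D ! i)) * (\<Prod>i<I. \<Prod>h<H. pmf (\<pi> (fst (D ! i ! h))) (snd (D ! i ! h)))"
proof -
  have "length (D ! i) = H" if "i < I" for i
    using assms(2) that by (auto simp: traj_tuples_def)
  then show ?thesis
    using assms(2)
    by (simp add: pmf_replicate_pmf traj_tuples_def pmf_traj_pmf[OF assms(1)] traj_prob_eq[OF assms(1)] prod.distrib)
qed

lemma set_replicate_traj_pmf:
  fixes P :: "('s::finite, 'a::finite) kernel"
  assumes "1 \<le> H"
  shows "set_pmf (replicate_pmf I (traj_pmf P \<rho> H \<pi>)) \<subseteq> traj_tuples I H"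
proof -
  have "length d = H" if "d \<in> set_pmf (traj_pmf P \<rho> H \<pi>)" for d
    using that by (auto simp: set_pmf_iff pmf_traj_pmf[OF assms] traj_prob_def split: if_splits)
  then show ?thesis
    by (auto simp: set_replicate_pmf traj_tuples_def)
qed

lemma upper_objective_eq:
  fixes P :: "('s::finite, 'a::finite) kernel"
  assumes "1 \<le> H"
  shows "upper_objective P \<rho> I H l x \<pi> =
    (\<Sum>D\<in>traj_tuples I H. pmf (replicate_pmf I (traj_pmf P \<rho> H \<pi>)) D * l D x)"
  unfolding upper_objective_def
  using set_replicate_traj_pmf[OF assms, where I=I and P=P and \<rho>=\<rho> and \<pi>=\<pi>]
  by (subst integral_measure_pmf_real[OF finite_traj_tuples]) (auto simp: mult.commute)

section \<open>The hyper-objective as an expectation under Gibbs weights\<close>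

context smooth_soft_mdp
begin

text \<open>The logarithm of the policy part is a sum of \<open>I * H\<close> log-probabilities, so
  the score of a tuple is the sum of its action scores.\<close>

lemma gibbs_weights_traj:
  fixes Pbar :: "('s, 'a) kernel"
  assumes "1 \<le> H"
  shows "gibbs_weights (traj_tuples I H) (\<lambda>D. \<Prod>i<I. env_weight Pbar \<rho> H (D ! i))
     (\<lambda>D x. \<Sum>i<I. \<Sum>h<H. log_policy (D ! i ! h) x) (\<lambda>D x. \<Sum>i<I. \<Sum>h<H. score (D ! i ! h) x)
     (real H * real I * score_bound)"
    and "D \<in> traj_tuples I H \<Longrightarrow> pmf (replicate_pmf I (traj_pmf Pbar \<rho> H (policy x))) D =
       (\<Prod>i<I. env_weight Pbar \<rho> H (D ! i)) * exp (\<Sum>i<I. \<Sum>h<H. log_policy (D ! i ! h) x)"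
proof -
  show *: "pmf (replicate_pmf I (traj_pmf Pbar \<rho> H (policy x))) D =
       (\<Prod>i<I. env_weight Pbar \<rho> H (D ! i)) * exp (\<Sum>i<I. \<Sum>h<H. log_policy (D ! i ! h) x)"
    if "D \<in> traj_tuples I H" for D x
    unfolding pmf_replicate_traj_pmf[OF assms that] policy_eq_exp by (simp add: exp_sum)
  show "gibbs_weights (traj_tuples I H) (\<lambda>D. \<Prod>i<I. env_weight Pbar \<rho> H (D ! i))
     (\<lambda>D x. \<Sum>i<I. \<Sum>h<H. log_policy (D ! i ! h) x) (\<lambda>D x. \<Sum>i<I. \<Sum>h<H. score (D ! i ! h) x)
     (real H * real I * score_bound)"
  proof
    show "finite (traj_tuples I H :: ('s, 'a) trajectory list set)"
      by (rule finite_traj_tuples)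
    show "0 \<le> (\<Prod>i<I. env_weight Pbar \<rho> H (D ! i))" for D
      by (intro prod_nonneg) (simp add: env_weight_def prod_nonneg)
    show "(\<Sum>D\<in>traj_tuples I H. (\<Prod>i<I. env_weight Pbar \<rho> H (D ! i)) *
        exp (\<Sum>i<I. \<Sum>h<H. log_policy (D ! i ! h) x)) = 1" for x
      using sum_pmf_eq_1[OF finite_traj_tuples set_replicate_traj_pmf[OF assms,
          where I=I and P=Pbar and \<rho>=\<rho> and \<pi>="policy x"]]
      by (simp add: *)
    show "GDERIV (\<lambda>x. \<Sum>i<I. \<Sum>h<H. log_policy (D ! i ! h) x) x :>
        (\<Sum>i<I. \<Sum>h<H. score (D ! i ! h) x)" for D x
      by (intro GDERIV_sum GDERIV_log_policy)
    show "norm (\<Sum>i<I. \<Sum>h<H. score (D ! i ! h) x) \<le> real H * real I * score_bound" for D x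
    proof -
      have "norm (\<Sum>h<H. score (D ! i ! h) x) \<le> real H * score_bound" for i
        using sum_norm_bound[of "{..<H}" "\<lambda>h. score (D ! i ! h) x"] norm_score_le by simp
      from sum_norm_bound[of "{..<I}", OF this] show ?thesis
        by (simp add: mult_ac)
    qed
  qed
qed

lemma traj_score_Lipschitz:
  "norm ((\<Sum>i<I. \<Sum>h<H. score (D ! i ! h) x) - (\<Sum>i<I. \<Sum>h<H. score (D ! i ! h) y))
    \<le> (real H * real I * (2 * inverse \<tau> * value_smoothness)) * norm (x - y)"
proof -
  have "norm (\<Sum>h<H. score (D ! i ! h) x - score (D ! i ! h) y)
      \<le> real H * (2 * inverse \<tau> * value_smoothness * norm (x - y))" for i
    using sum_norm_bound[of "{..<H}" "\<lambda>h. score (D ! i ! h) x - score (D ! i ! h) y"] score_Lipschitz by simp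
  from sum_norm_bound[of "{..<I}", OF this] show ?thesis
    by (simp add: mult_ac sum_subtractf)
qed

text \<open>\<open>expectation_smooth\<close> for the trajectory weights, with \<open>G\<close>
  equal to \<open>H * I\<close> times \<open>score_bound\<close> and \<open>G'\<close> equal to
  \<open>H * I\<close> times the Lipschitz constant of the action score.\<close>

lemma hyper_objective_smooth:
  fixes Pbar :: "('s, 'a) kernel" and l :: "('s, 'a) trajectory list \<Rightarrow> 'v \<Rightarrow> real"
  assumes \<rho>: "\<And>s. 0 < pmf \<rho> s" and H: "1 \<le> H"
    and l: "\<And>D x. D \<in> traj_tuples I H \<Longrightarrow> GDERIV (l D) x :> l' D x"
    and l_le: "\<And>D x. D \<in> traj_tuples I H \<Longrightarrow> \<bar>l D x\<bar> \<le> C_l"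
    and l_lip: "\<And>D x1 x2. D \<in> traj_tuples I H \<Longrightarrow> \<bar>l D x1 - l D x2\<bar> \<le> L_l * norm (x1 - x2)"
    and l'_lip: "\<And>D x1 x2. D \<in> traj_tuples I H \<Longrightarrow> norm (l' D x1 - l' D x2) \<le> L_l1 * norm (x1 - x2)"
  shows "\<exists>\<phi>'. (\<forall>x. GDERIV (hyper_objective P \<gamma> \<tau> \<rho> r Pbar \<rho>bar I H l) x :> \<phi>' x) \<and>
    (\<forall>x1 x2. norm (\<phi>' x1 - \<phi>' x2) \<le>
      (L_l1 + (C_l * (real H * real I * (2 * inverse \<tau> * value_smoothness))
          + L_l * (real H * real I * score_bound))
        + real H * real I * score_bound * (L_l + C_l * (real H * real I * score_bound)))
      * norm (x1 - x2))"
proof -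
  interpret W: gibbs_weights "traj_tuples I H :: ('s, 'a) trajectory list set"
    "\<lambda>D. \<Prod>i<I. env_weight Pbar \<rho>bar H (D ! i)"
    "\<lambda>D x. \<Sum>i<I. \<Sum>h<H. log_policy (D ! i ! h) x" "\<lambda>D x. \<Sum>i<I. \<Sum>h<H. score (D ! i ! h) x"
    "real H * real I * score_bound"
    by (rule gibbs_weights_traj[OF H])
  have l'_le: "norm (l' D x) \<le> L_l" if "D \<in> traj_tuples I H" for D x
    using l[OF that] l_lip[OF that] by (rule norm_GDERIV_le)
  have \<phi>: "hyper_objective P \<gamma> \<tau> \<rho> r Pbar \<rho>bar I H l = (\<lambda>x. \<Sum>D\<in>traj_tuples I H. W.weight D x * l D x)"
    by (rule ext) (simp add: hyper_objective_def optimal_policy_eq[OF \<rho>]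
        upper_objective_eq[OF H] gibbs_weights_traj(2)[OF H])
  note smooth = W.expectation_smooth[OF l l_le l_lip l'_le l'_lip traj_score_Lipschitz]
  show ?thesis
    unfolding \<phi> by (intro exI conjI allI, rule smooth(1), assumption+, rule smooth(2), assumption+)
qed

end

section \<open>Comparison with the stated constants\<close>

theorem proposition7p5:
  fixes P Pbar :: "('s::finite, 'a::finite) kernel"
    and \<rho> \<rho>bar :: "'s pmf"
    and \<gamma> \<tau> :: real
    and r :: "real ^ 'n \<Rightarrow> 's \<Rightarrow> 'a \<Rightarrow> real"
    and I H :: nat
    and l :: "('s, 'a) trajectory list \<Rightarrow> real ^ 'n \<Rightarrow> real"
    and C_r C_rx L_r C_l L_l L_l1 :: real
  assumes "0 < \<gamma>" and "\<gamma> < 1" and "0 < \<tau>"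
    and "\<And>s. 0 < pmf \<rho> s"
    and "1 \<le> I" and "1 \<le> H"
    and "\<And>s a. continuously_differentiable (\<lambda>x. r x s a)"
    and "\<And>s a x. \<bar>r x s a\<bar> \<le> C_r"
    and "\<And>s a x. norm (gradient (\<lambda>x. r x s a) x) \<le> C_rx"
    and "\<And>s a x1 x2. norm (gradient (\<lambda>x. r x s a) x1 - gradient (\<lambda>x. r x s a) x2)
           \<le> L_r * norm (x1 - x2)"
    and "\<And>D x. D \<in> traj_tuples I H \<Longrightarrow> \<bar>l D x\<bar> \<le> C_l"
    and "\<And>D. D \<in> traj_tuples I H \<Longrightarrow> continuously_differentiable (l D)"
    and "\<And>D x1 x2. D \<in> traj_tuples I H \<Longrightarrow> \<bar>l D x1 - l D x2\<bar> \<le> L_l * norm (x1 - x2)"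
    and "\<And>D x1 x2. D \<in> traj_tuples I H \<Longrightarrow>
           norm (gradient (l D) x1 - gradient (l D) x2) \<le> L_l1 * norm (x1 - x2)"
  shows "let \<phi> = hyper_objective P \<gamma> \<tau> \<rho> r Pbar \<rho>bar I H l;
             nS = real CARD('s);
             nA = real CARD('a);
             L_\<pi> = 2 * sqrt (nS * nA) * C_rx / (\<tau> * (1 - \<gamma>));
             L_V1 = (1 + \<gamma>) * C_rx * L_\<pi> * sqrt nA / (1 - \<gamma>)\<^sup>2 + L_r / (1 - \<gamma>);
             L_\<phi> = L_l1 + L_l * real H * real I * L_\<pi> * sqrt nA
                   + 2 * inverse \<tau> * real H * real I * (C_l * L_V1 + C_rx / (1 - \<gamma>) * L_l)
                   + 2 * (real H)\<^sup>2 * (real I)\<^sup>2 * C_l * C_rx * L_\<pi> / (\<tau> * (1 - \<gamma>)) * sqrt nA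
         in (\<forall>x. \<phi> differentiable (at x)) \<and>
            (\<forall>x1 x2. norm (gradient \<phi> x1 - gradient \<phi> x2) \<le> L_\<phi> * norm (x1 - x2))"
proof -
  define nS nA where "nS = real CARD('s)" and "nA = real CARD('a)"
  define L_\<pi> where "L_\<pi> = 2 * sqrt (nS * nA) * C_rx / (\<tau> * (1 - \<gamma>))"
  define L_V1 where "L_V1 = (1 + \<gamma>) * C_rx * L_\<pi> * sqrt nA / (1 - \<gamma>)\<^sup>2 + L_r / (1 - \<gamma>)"
  define L_\<phi> where "L_\<phi> = L_l1 + L_l * real H * real I * L_\<pi> * sqrt nA
                   + 2 * inverse \<tau> * real H * real I * (C_l * L_V1 + C_rx / (1 - \<gamma>) * L_l)
                   + 2 * (real H)\<^sup>2 * (real I)\<^sup>2 * C_l * C_rx * L_\<pi> / (\<tau> * (1 - \<gamma>)) * sqrt nA"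
  let ?\<phi> = "hyper_objective P \<gamma> \<tau> \<rho> r Pbar \<rho>bar I H l"
  note \<gamma> = assms(1,2) and \<tau> = assms(3)
  interpret smooth_soft_mdp P \<gamma> \<tau> r "\<lambda>x s a. gradient (\<lambda>x. r x s a) x" C_rx L_r
    using assms(1-3,7,9,10) by unfold_locales (auto simp: continuously_differentiable_def intro: GDERIV_gradient)
  have l: "GDERIV (l D) x :> gradient (l D) x" if "D \<in> traj_tuples I H" for D x
    using assms(12)[OF that] by (auto simp: continuously_differentiable_def intro: GDERIV_gradient)
  have "\<exists>\<phi>'. (\<forall>x. GDERIV ?\<phi> x :> \<phi>' x) \<and> (\<forall>x1 x2. norm (\<phi>' x1 - \<phi>' x2) \<le>
      (L_l1 + (C_l * (real H * real I * (2 * inverse \<tau> * value_smoothness))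
          + L_l * (real H * real I * score_bound))
        + real H * real I * score_bound * (L_l + C_l * (real H * real I * score_bound)))
      * norm (x1 - x2))"
    by (rule hyper_objective_smooth[where l'="\<lambda>D. gradient (l D)"]) (fact assms l)+
  then obtain \<phi>' where \<phi>': "\<And>x. GDERIV ?\<phi> x :> \<phi>' x"
    and \<phi>'_lip: "\<And>x1 x2. norm (\<phi>' x1 - \<phi>' x2) \<le>
      (L_l1 + (C_l * (real H * real I * (2 * inverse \<tau> * value_smoothness))
          + L_l * (real H * real I * score_bound))
        + real H * real I * score_bound * (L_l + C_l * (real H * real I * score_bound)))
      * norm (x1 - x2)"
    by blast
  \<comment> \<open>A trajectory tuple exists, so the bounds on \<open>l\<close> force
    \<open>C_l\<close> and \<open>L_l\<close> to be nonnegative, as the monotonicity steps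
    require.\<close>
  have traj: "\<exists>D :: ('s, 'a) trajectory list. D \<in> traj_tuples I H"
    by (intro exI[of _ "replicate I (replicate H undefined)"]) (simp add: traj_tuples_def)
  have C_l: "0 \<le> C_l"
    using traj order_trans[OF abs_ge_zero assms(11)] by blast
  have L_l: "0 \<le> L_l"
  proof -
    obtain D :: "('s, 'a) trajectory list" where "D \<in> traj_tuples I H"
      using traj by blast
    \<comment> \<open>\<open>axis undefined 1\<close> is a unit vector, so its distance from 0 is
      1.\<close>
    from order_trans[OF abs_ge_zero assms(13)[OF this, of "axis undefined 1" 0]] show ?thesis
      by simp
  qed
  have K: "score_bound \<le> L_\<pi> * sqrt nA"
  proof -
    \<comment> \<open>\<open>L_\<pi> * sqrt nA\<close> is \<open>score_bound\<close> times
      \<open>sqrt (nS * nA) * sqrt nA\<close>, and both cardinalities are at least one.\<close>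
    have "1 \<le> nS" "1 \<le> nA"
      by (simp_all add: nS_def nA_def Suc_le_eq)
    then have "1 * 1 \<le> sqrt (nS * nA) * sqrt nA"
      by (intro mult_mono) (auto intro: order_trans[OF _ mult_mono[of 1 nS 1 nA]])
    from mult_left_mono[OF this score_bound_nonneg] show ?thesis
      by (simp add: score_bound_def L_\<pi>_def mult_ac)
  qed
  have V1: "value_smoothness \<le> L_V1"
  proof -
    \<comment> \<open>\<open>value_smoothness\<close> has the shape of \<open>L_V1\<close>, with
      \<open>score_bound\<close> in place of
      \<open>(1 + \<gamma>) * L_\<pi> * sqrt nA\<close>.\<close>
    have "score_bound * C_rx \<le> (1 + \<gamma>) * (L_\<pi> * sqrt nA) * C_rx"
      using mult_mono[of 1 "1 + \<gamma>", OF _ K] \<gamma> score_bound_nonneg C_nonneg by (intro mult_right_mono) auto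
    then have "score_bound * C_rx / (1 - \<gamma>)\<^sup>2 \<le> (1 + \<gamma>) * (L_\<pi> * sqrt nA) * C_rx / (1 - \<gamma>)\<^sup>2"
      by (rule divide_right_mono) simp
    then show ?thesis
      by (simp add: value_smoothness_def L_V1_def add_divide_distrib power2_eq_square mult_ac)
  qed
  define N where "N = real H * real I"
  have N: "0 \<le> N"
    by (simp add: N_def)
  have bound: "L_l1 + (C_l * (N * (2 * inverse \<tau> * value_smoothness)) + L_l * (N * score_bound))
        + N * score_bound * (L_l + C_l * (N * score_bound)) \<le> L_\<phi>"
  proof -
    have "C_l * (N * (2 * inverse \<tau> * value_smoothness)) \<le> C_l * (N * (2 * inverse \<tau> * L_V1))"
      using C_l N \<tau> V1 by (intro mult_left_mono) auto
    moreover have "N * score_bound * (L_l + C_l * (N * score_bound))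
        \<le> N * (L_\<pi> * sqrt nA) * (L_l + C_l * (N * score_bound))"
      using C_l L_l N K score_bound_nonneg by (intro mult_right_mono mult_left_mono) auto
    \<comment> \<open>In the last product only the outer \<open>score_bound\<close> is enlarged. The
      remaining occurrences equal the factors \<open>2 * C_rx / (\<tau> * (1 - \<gamma>))\<close>
      present in \<open>L_\<phi>\<close>, so this is an equality.\<close>
    moreover have "L_\<phi> = L_l1 + (C_l * (N * (2 * inverse \<tau> * L_V1)) + L_l * (N * score_bound))
        + N * (L_\<pi> * sqrt nA) * (L_l + C_l * (N * score_bound))"
      unfolding L_\<phi>_def N_def score_bound_def divide_inverse inverse_mult_distrib
      by (simp add: algebra_simps power2_eq_square)
    ultimately show ?thesis
      by linarith
  qed
  have "?\<phi> differentiable (at x)" for x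
    using \<phi>'[of x] unfolding gderiv_def differentiable_def by blast
  moreover have "norm (gradient ?\<phi> x1 - gradient ?\<phi> x2) \<le> L_\<phi> * norm (x1 - x2)" for x1 x2
    unfolding gradient_eqI[OF \<phi>']
    by (rule order_trans[OF \<phi>'_lip]) (use bound in \<open>simp add: N_def mult_right_mono\<close>)
  ultimately show ?thesis
    unfolding Let_def L_\<phi>_def L_V1_def L_\<pi>_def nS_def nA_def by (intro conjI allI)
qed

end
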